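(* Let $N\ge 1$, $M\ge 1$ and $0\le n\le M$ be integers. For each $k=1,\dots,n$ let $b_k=(b_k^1,\dots,b_k^N)\in\{0,1,2,3\}^N$, let $h_{b_k}$ be a nonzero real number, and set $$P_{b_k}:=\bigotimes_{i=1}^N\sigma_{b_k^i},\qquad H_{b_k}:=|h_{b_k}|\left[\operatorname{sgn}(h_{b_k})\,P_{b_k}+2M\,I\right]$$ as operators on $(\mathbb{C}^2)^{\otimes N}$. Then the Hermitian operator $$H_{b_1}H_{b_2}\cdots H_{b_n}+H_{b_n}\cdots H_{b_2}H_{b_1}$$ is positive semidefinite; in particular $\operatorname{Re}\langle\alpha|H_{b_n}\cdots H_{b_1}|\alpha\rangle\ge 0$ for every unit vector $|\alpha\rangle\in(\mathbb{C}^2)^{\otimes N}$. Moreover, for every such $|\alpha\rangle$, with the state $|\psi_{\mathrm{in}}\rangle$ and the unitary $V$ defined in the context, $$\langle\psi_{\mathrm{in}}|V|\psi_{\mathrm{in}}\rangle=\frac{\operatorname{Re}\langle\alpha|H_{b_n}\cdots H_{b_1}|\alpha\rangle}{(2M+1)^n\,|h_{b_n}\cdots h_{b_1}|}.$$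
   Context: $\sigma_0=I$ is the $2\times 2$ identity and $\sigma_1,\sigma_2,\sigma_3$ are the Pauli matrices $\sigma_x,\sigma_y,\sigma_z$. For $n=0$ empty products of operators are the identity and empty products of scalars are $1$. Consider the Hilbert space $A\otimes B_1\otimes\cdots\otimes B_n\otimes C$, where $A=(\mathbb{C}^2)^{\otimes N}$ and each of $B_1,\dots,B_n,C$ is a copy of $\mathbb{C}^2$ with orthonormal basis $|0\rangle,|1\rangle$. Set $$|\phi\rangle:=\sqrt{\tfrac{2M}{2M+1}}\,|0\rangle+\sqrt{\tfrac{1}{2M+1}}\,|1\rangle,\qquad |+\rangle:=\tfrac{1}{\sqrt2}(|0\rangle+|1\rangle),$$ $$|\psi_{\mathrm{in}}\rangle:=|\alpha\rangle_A\otimes|\phi\rangle_{B_1}\otimes\cdots\otimes|\phi\rangle_{B_n}\otimes|+\rangle_C .$$ For each $k$, $U_k$ is the controlled unitary acting on $A$ and $B_k$ (and trivially on the other factors) given by $$U_k\,|v\rangle_A|0\rangle_{B_k}=|v\rangle_A|0\rangle_{B_k},\qquad U_k\,|v\rangle_A|1\rangle_{B_k}=\left(\operatorname{sgn}(h_{b_k})P_{b_k}|v\rangle_A\right)|1\rangle_{B_k}$$ for all $|v\rangle\in A$. The unitary $V$ is controlled by $C$: for all $|w\rangle\in A\otimes B_1\otimes\cdots\otimes B_n$, $$V\,|w\rangle|0\rangle_C=\left(U_1U_2\cdots U_n|w\rangle\right)|0\rangle_C,\qquad V\,|w\rangle|1\rangle_C=\left(U_n\cdots U_2U_1|w\rangle\right)|1\rangle_C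 .$$ *)

theory Defs
  imports "Jordan_Normal_Form.Schur_Decomposition"
begin

(* A tensor product of spaces of dimensions d and e is the space of dimension d * e.  Product basis
   vectors are listed lexicographically, so the leftmost tensor factor is the most significant. *)

definition kron_vec :: "complex vec \<Rightarrow> complex vec \<Rightarrow> complex vec" where
  "kron_vec v w = vec (dim_vec v * dim_vec w)
     (\<lambda>i. v $ (i div dim_vec w) * w $ (i mod dim_vec w))"

definition kron_mat :: "complex mat \<Rightarrow> complex mat \<Rightarrow> complex mat" where
  "kron_mat A B = mat (dim_row A * dim_row B) (dim_col A * dim_col B)
     (\<lambda>(i, j). A $$ (i div dim_row B, j div dim_col B) * B $$ (i mod dim_row B, j mod dim_col B))"

definition kron_vecs :: "complex vec list \<Rightarrow> complex vec" where
  "kron_vecs vs = foldr kron_vec vs (vec 1 (\<lambda>_. 1))"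

definition kron_mats :: "complex mat list \<Rightarrow> complex mat" where
  "kron_mats As = foldr kron_mat As (1\<^sub>m 1)"

(* The ordinary product, in list order, of d x d matrices. *)
definition mat_prod :: "nat \<Rightarrow> complex mat list \<Rightarrow> complex mat" where
  "mat_prod d As = foldr (*) As (1\<^sub>m d)"

(* <u|v>, conjugate-linear in u. *)
definition braket :: "complex vec \<Rightarrow> complex vec \<Rightarrow> complex" where
  "braket u v = v \<bullet>c u"

definition hermitian_mat :: "complex mat \<Rightarrow> bool" where
  "hermitian_mat A \<longleftrightarrow> square_mat A \<and> mat_adjoint A = A"

definition psd_mat :: "complex mat \<Rightarrow> bool" where
  "psd_mat A \<longleftrightarrow> hermitian_mat A \<and> (\<forall>v \<in> carrier_vec (dim_row A). 0 \<le> Re (braket v (A *\<^sub>v v)))"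

definition ket :: "nat \<Rightarrow> complex vec" where
  "ket c = unit_vec 2 c"

(* The projector |c><c|. *)
definition ket_proj :: "nat \<Rightarrow> complex mat" where
  "ket_proj c = mat 2 2 (\<lambda>(i, j). ket c $ i * cnj (ket c $ j))"

(* Only the arguments 0, 1, 2, 3 are meaningful. *)
definition pauli :: "nat \<Rightarrow> complex mat" where
  "pauli c = [1\<^sub>m 2,
              mat_of_rows_list 2 [[0, 1], [1, 0]],
              mat_of_rows_list 2 [[0, - \<i>], [\<i>, 0]],
              mat_of_rows_list 2 [[1, 0], [0, - 1]]] ! c"

(* A multi-index (b^1, ..., b^N) is a function on {1..N}. *)
definition pauli_string :: "nat \<Rightarrow> (nat \<Rightarrow> nat) \<Rightarrow> complex mat" where
  "pauli_string N b = kron_mats (map (\<lambda>i. pauli (b i)) [1..<Suc N])"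

definition H_term :: "nat \<Rightarrow> nat \<Rightarrow> real \<Rightarrow> (nat \<Rightarrow> nat) \<Rightarrow> complex mat" where
  "H_term N M h b = complex_of_real \<bar>h\<bar> \<cdot>\<^sub>m
     (complex_of_real (sgn h) \<cdot>\<^sub>m pauli_string N b + complex_of_real (2 * real M) \<cdot>\<^sub>m 1\<^sub>m (2 ^ N))"

definition ket_phi :: "nat \<Rightarrow> complex vec" where
  "ket_phi M = complex_of_real (sqrt (2 * real M / (2 * real M + 1))) \<cdot>\<^sub>v ket 0
             + complex_of_real (sqrt (1 / (2 * real M + 1))) \<cdot>\<^sub>v ket 1"

definition ket_plus :: "complex vec" where
  "ket_plus = complex_of_real (1 / sqrt 2) \<cdot>\<^sub>v (ket 0 + ket 1)"

definition psi_in :: "nat \<Rightarrow> nat \<Rightarrow> complex vec \<Rightarrow> complex vec" where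
  "psi_in M n \<alpha> = kron_vecs ([\<alpha>] @ replicate n (ket_phi M) @ [ket_plus])"

(* The operator X \<otimes> |c><c| on A and B_k, extended by the identity to A, B_1, ..., B_n. *)
definition on_branch :: "nat \<Rightarrow> nat \<Rightarrow> nat \<Rightarrow> complex mat \<Rightarrow> complex mat" where
  "on_branch n k c X = kron_mats (X # map (\<lambda>j. if j = k then ket_proj c else 1\<^sub>m 2) [1..<Suc n])"

(* U_k as an operator on A, B_1, ..., B_n (without C); it is characterised by the lemmas
   ctrl_U_ket0 and ctrl_U_ket1 below. *)
definition ctrl_U :: "nat \<Rightarrow> nat \<Rightarrow> (nat \<Rightarrow> real) \<Rightarrow> (nat \<Rightarrow> nat \<Rightarrow> nat) \<Rightarrow> nat \<Rightarrow> complex mat" where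
  "ctrl_U N n h b k = on_branch n k 0 (1\<^sub>m (2 ^ N))
     + on_branch n k 1 (complex_of_real (sgn (h k)) \<cdot>\<^sub>m pauli_string N (b k))"

(* V on A, B_1, ..., B_n, C; it is characterised by the lemmas ctrl_V_ket0 and ctrl_V_ket1 below. *)
definition ctrl_V :: "nat \<Rightarrow> nat \<Rightarrow> (nat \<Rightarrow> real) \<Rightarrow> (nat \<Rightarrow> nat \<Rightarrow> nat) \<Rightarrow> complex mat" where
  "ctrl_V N n h b =
     kron_mat (mat_prod (2 ^ N * 2 ^ n) (map (ctrl_U N n h b) [1..<Suc n])) (ket_proj 0)
   + kron_mat (mat_prod (2 ^ N * 2 ^ n) (map (ctrl_U N n h b) (rev [1..<Suc n]))) (ket_proj 1)"

lemma kron_vec_dim [simp]: "dim_vec (kron_vec v w) = dim_vec v * dim_vec w"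
  by (simp add: kron_vec_def)

lemma kron_mat_dim [simp]: "dim_row (kron_mat A B) = dim_row A * dim_row B"
  "dim_col (kron_mat A B) = dim_col A * dim_col B"
  by (simp_all add: kron_mat_def)

lemma kron_vecs_simps [simp]: "kron_vecs [] = vec 1 (\<lambda>_. 1)"
  "kron_vecs (v # vs) = kron_vec v (kron_vecs vs)"
  by (simp_all add: kron_vecs_def)

lemma kron_mats_simps [simp]: "kron_mats [] = 1\<^sub>m 1"
  "kron_mats (A # As) = kron_mat A (kron_mats As)"
  by (simp_all add: kron_mats_def)

lemma mat_prod_carrier:
  "(\<And>A. A \<in> set As \<Longrightarrow> A \<in> carrier_mat d d) \<Longrightarrow> mat_prod d As \<in> carrier_mat d d"
  by (induction As) (auto simp: mat_prod_def intro!: mult_carrier_mat)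

lemma index_pair_less:
  assumes "i < (m::nat)" "j < n" shows "i * n + j < m * n"
proof -
  have "i * n + j < Suc i * n" using assms by simp
  also have "\<dots> \<le> m * n" using assms by (intro mult_le_mono1) auto
  finally show ?thesis .
qed

lemma sum_prod_index:
  fixes f g :: "nat \<Rightarrow> complex"
  shows "(\<Sum>j<m * n. f (j div n) * g (j mod n)) = (\<Sum>i<m. f i) * (\<Sum>j<n. g j)"
proof (cases "n = 0")
  case False
  have "(\<Sum>j<m * n. f (j div n) * g (j mod n)) = (\<Sum>(i,j)\<in>{..<m} \<times> {..<n}. f i * g j)"
    by (rule sum.reindex_bij_witness[of _ "\<lambda>(i,j). i * n + j" "\<lambda>j. (j div n, j mod n)"])
      (use False in \<open>auto simp: less_mult_imp_div_less intro!: index_pair_less\<close>)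
  then show ?thesis by (simp add: sum_product sum.cartesian_product)
qed simp

lemma kron_mat_mult_kron_vec:
  assumes "dim_vec v = dim_col A" "dim_vec w = dim_col B"
  shows "kron_mat A B *\<^sub>v kron_vec v w = kron_vec (A *\<^sub>v v) (B *\<^sub>v w)"
proof (rule eq_vecI)
  fix i assume "i < dim_vec (kron_vec (A *\<^sub>v v) (B *\<^sub>v w))"
  then have i: "i < dim_row A * dim_row B" by simp
  then have pos: "dim_row B > 0" by (cases "dim_row B") auto
  have d: "i div dim_row B < dim_row A" using i by (simp add: less_mult_imp_div_less)
  have m: "i mod dim_row B < dim_row B" using pos by simp
  have "(kron_mat A B *\<^sub>v kron_vec v w) $ i =
      (\<Sum>j<dim_col A * dim_col B. (A $$ (i div dim_row B, j div dim_col B) * v $ (j div dim_col B)) *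
         (B $$ (i mod dim_row B, j mod dim_col B) * w $ (j mod dim_col B)))"
    using i assms by (auto simp: scalar_prod_def kron_mat_def kron_vec_def lessThan_atLeast0 intro!: sum.cong)
  also have "\<dots> = (\<Sum>j<dim_col A. A $$ (i div dim_row B, j) * v $ j) *
      (\<Sum>j<dim_col B. B $$ (i mod dim_row B, j) * w $ j)"
    by (rule sum_prod_index)
  also have "\<dots> = (A *\<^sub>v v) $ (i div dim_row B) * (B *\<^sub>v w) $ (i mod dim_row B)"
    using d m assms by (auto simp: scalar_prod_def lessThan_atLeast0 intro!: arg_cong2[where f = "(*)"] sum.cong)
  also have "\<dots> = kron_vec (A *\<^sub>v v) (B *\<^sub>v w) $ i"
    using i by (simp add: kron_vec_def)
  finally show "(kron_mat A B *\<^sub>v kron_vec v w) $ i = kron_vec (A *\<^sub>v v) (B *\<^sub>v w) $ i" .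
qed simp

lemma kron_mats_mult_kron_vecs:
  assumes "list_all2 (\<lambda>A v. dim_vec v = dim_col A) As vs"
  shows "dim_vec (kron_vecs vs) = dim_col (kron_mats As) \<and>
    kron_mats As *\<^sub>v kron_vecs vs = kron_vecs (map2 (*\<^sub>v) As vs)"
  using assms by (induction) (auto simp: kron_mat_mult_kron_vec)

lemma dim_kron_vecs: "dim_vec (kron_vecs vs) = prod_list (map dim_vec vs)"
  by (induction vs) auto

lemma dim_kron_mats: "dim_row (kron_mats As) = prod_list (map dim_row As)"
  "dim_col (kron_mats As) = prod_list (map dim_col As)"
  by (induction As) auto

lemma kron_vec_zero_left: "kron_vec (0\<^sub>v d) w = 0\<^sub>v (d * dim_vec w)"
  by (rule eq_vecI) (auto simp: kron_vec_def less_mult_imp_div_less)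

lemma kron_vec_zero_right: "kron_vec v (0\<^sub>v d) = 0\<^sub>v (dim_vec v * d)"
proof (rule eq_vecI)
  fix i assume i: "i < dim_vec (0\<^sub>v (dim_vec v * d))"
  then have "d > 0" by (cases d) auto
  with i show "kron_vec v (0\<^sub>v d) $ i = 0\<^sub>v (dim_vec v * d) $ i" by (auto simp: kron_vec_def)
qed simp

lemma kron_vecs_zero:
  "0\<^sub>v d \<in> set vs \<Longrightarrow> kron_vecs vs = 0\<^sub>v (prod_list (map dim_vec vs))"
  by (induction vs) (auto simp: kron_vec_zero_left kron_vec_zero_right dim_kron_vecs)

lemma ket_proj_mult_ket:
  assumes "c < 2" "c' < 2"
  shows "ket_proj c *\<^sub>v ket c' = (if c = c' then ket c else 0\<^sub>v 2)"
proof (rule eq_vecI)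
  fix i assume "i < dim_vec (if c = c' then ket c else 0\<^sub>v 2)"
  then have "i = 0 \<or> i = 1" by (auto simp: ket_def split: if_splits)
  moreover have "c = 0 \<or> c = 1" "c' = 0 \<or> c' = 1" using assms by auto
  ultimately show "(ket_proj c *\<^sub>v ket c') $ i = (if c = c' then ket c else 0\<^sub>v 2) $ i"
    by (auto simp: ket_proj_def ket_def scalar_prod_def numeral_2_eq_2)
qed (auto simp: ket_proj_def ket_def)

lemma pauli_carrier: "c \<in> {0, 1, 2, 3} \<Longrightarrow> pauli c \<in> carrier_mat 2 2"
  by (auto simp: pauli_def mat_of_rows_list_def)

lemma pauli_string_carrier:
  assumes "\<And>i. i \<in> {1..N} \<Longrightarrow> b i \<in> {0, 1, 2, 3}"
  shows "pauli_string N b \<in> carrier_mat (2 ^ N) (2 ^ N)"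
proof -
  have p: "dim_row (pauli (b i)) = 2 \<and> dim_col (pauli (b i)) = 2" if "i \<in> set [1..<Suc N]" for i
    using pauli_carrier[OF assms, of i] that by (auto simp del: upt_Suc)
  have "map (\<lambda>i. dim_row (pauli (b i))) [1..<Suc N] = map (\<lambda>_. 2) [1..<Suc N]"
    "map (\<lambda>i. dim_col (pauli (b i))) [1..<Suc N] = map (\<lambda>_. 2) [1..<Suc N]"
    using p by (auto simp del: upt_Suc intro: map_cong)
  then show ?thesis
    unfolding pauli_string_def
    by (intro carrier_matI) (simp_all only: dim_kron_mats map_map o_def map_replicate_const prod_list_replicate, simp_all)
qed

lemma on_branch_carrier:
  assumes "X \<in> carrier_mat (2 ^ N) (2 ^ N)"
  shows "on_branch n k c X \<in> carrier_mat (2 ^ N * 2 ^ n) (2 ^ N * 2 ^ n)"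
proof -
  let ?f = "\<lambda>j. if j = k then ket_proj c else 1\<^sub>m 2"
  have "map (dim_row \<circ> ?f) [1..<Suc n] = map (\<lambda>_. 2) [1..<Suc n]"
    "map (dim_col \<circ> ?f) [1..<Suc n] = map (\<lambda>_. 2) [1..<Suc n]"
    by (auto simp: ket_proj_def)
  then have "prod_list (map (dim_row \<circ> ?f) [1..<Suc n]) = 2 ^ n"
    "prod_list (map (dim_col \<circ> ?f) [1..<Suc n]) = 2 ^ n"
    by (simp_all only: map_replicate_const prod_list_replicate, simp_all)
  then show ?thesis
    using assms unfolding on_branch_def
    by (intro carrier_matI) (simp_all only: kron_mats_simps kron_mat_dim dim_kron_mats map_map, auto)
qed

lemma on_branch_mult:
  assumes X: "X \<in> carrier_mat (2 ^ N) (2 ^ N)" and v: "v \<in> carrier_vec (2 ^ N)"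
    and ws: "length ws = n" "set ws \<subseteq> carrier_vec 2"
    and k: "k \<in> {1..n}" and c: "ws ! (k - 1) = ket c'" "c < 2" "c' < 2"
  shows "on_branch n k c X *\<^sub>v kron_vecs (v # ws) =
    (if c = c' then kron_vecs ((X *\<^sub>v v) # ws) else 0\<^sub>v (2 ^ N * 2 ^ n))"
proof -
  let ?B = "map (\<lambda>j. if j = k then ket_proj c else 1\<^sub>m 2) [1..<Suc n]"
  have len: "length ?B = n" by simp
  have wsi: "ws ! i \<in> carrier_vec 2" if "i < n" for i
    using ws that by (metis nth_mem subsetD)
  have Bi: "?B ! i = (if Suc i = k then ket_proj c else 1\<^sub>m 2)" if "i < n" for i
    using that by (auto simp del: upt_Suc)
  have la: "list_all2 (\<lambda>A v. dim_vec v = dim_col A) (X # ?B) (v # ws)"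
    using X v ws wsi Bi by (auto simp: list_all2_conv_all_nth ket_proj_def nth_Cons simp del: upt_Suc split: nat.split)
  have eq: "on_branch n k c X *\<^sub>v kron_vecs (v # ws) = kron_vecs ((X *\<^sub>v v) # map2 (*\<^sub>v) ?B ws)"
    unfolding on_branch_def using kron_mats_mult_kron_vecs[OF la] by (simp del: upt_Suc kron_mats_simps kron_vecs_simps)
  show ?thesis
  proof (cases "c = c'")
    case True
    have "map2 (*\<^sub>v) ?B ws = ws"
    proof (rule nth_equalityI)
      fix i assume "i < length (map2 (*\<^sub>v) ?B ws)"
      then have i: "i < n" using ws by (simp del: upt_Suc)
      then have "map2 (*\<^sub>v) ?B ws ! i = ?B ! i *\<^sub>v ws ! i"
        using ws len by (simp del: upt_Suc)
      also have "\<dots> = ws ! i"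
        unfolding Bi[OF i] using True c wsi[OF i] ket_proj_mult_ket[of c c] by auto
      finally show "map2 (*\<^sub>v) ?B ws ! i = ws ! i" .
    qed (use ws in \<open>simp del: upt_Suc\<close>)
    then show ?thesis using eq True by simp
  next
    case False
    have i: "k - 1 < n" "Suc (k - 1) = k" using k by auto
    have "map2 (*\<^sub>v) ?B ws ! (k - 1) = ?B ! (k - 1) *\<^sub>v ws ! (k - 1)"
      using ws len i by (simp del: upt_Suc)
    also have "\<dots> = 0\<^sub>v 2"
      unfolding Bi[OF i(1)] using i False c ket_proj_mult_ket[of c c'] by simp
    finally have z: "map2 (*\<^sub>v) ?B ws ! (k - 1) = 0\<^sub>v 2" .
    have "k - 1 < length (map2 (*\<^sub>v) ?B ws)" using i ws by (simp del: upt_Suc)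
    then have "0\<^sub>v 2 \<in> set (map2 (*\<^sub>v) ?B ws)"
      unfolding z[symmetric] by (rule nth_mem)
    then have "kron_vecs ((X *\<^sub>v v) # map2 (*\<^sub>v) ?B ws) =
        0\<^sub>v (prod_list (map dim_vec ((X *\<^sub>v v) # map2 (*\<^sub>v) ?B ws)))"
      by (intro kron_vecs_zero) (rule list.set_intros(2))
    then obtain e where "kron_vecs ((X *\<^sub>v v) # map2 (*\<^sub>v) ?B ws) = 0\<^sub>v e" ..
    then have e: "on_branch n k c X *\<^sub>v kron_vecs (v # ws) = 0\<^sub>v e" unfolding eq .
    moreover have "dim_vec (on_branch n k c X *\<^sub>v kron_vecs (v # ws)) = 2 ^ N * 2 ^ n"
      using on_branch_carrier[OF X, of n k c] by simp
    ultimately have "e = 2 ^ N * 2 ^ n" by (simp only: index_zero_vec(2))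
    then show ?thesis unfolding e using False by (simp only: if_False)
  qed
qed

lemma kron_vecs_carrier:
  assumes "v \<in> carrier_vec (2 ^ N)" "length ws = n" "set ws \<subseteq> carrier_vec 2"
  shows "kron_vecs (v # ws) \<in> carrier_vec (2 ^ N * 2 ^ n)"
proof -
  have "prod_list (map dim_vec ws) = 2 ^ length ws" using assms(3) by (induction ws) auto
  then show ?thesis using assms by (intro carrier_vecI) (simp add: dim_kron_vecs)
qed

lemma ctrl_U_carrier:
  assumes "\<And>i. i \<in> {1..N} \<Longrightarrow> b k i \<in> {0, 1, 2, 3}"
  shows "ctrl_U N n h b k \<in> carrier_mat (2 ^ N * 2 ^ n) (2 ^ N * 2 ^ n)"
  unfolding ctrl_U_def
  by (rule add_carrier_mat, rule on_branch_carrier, rule smult_carrier_mat,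
      rule pauli_string_carrier, rule assms)

lemma
  assumes b: "\<And>i. i \<in> {1..N} \<Longrightarrow> b k i \<in> {0, 1, 2, 3}" and k: "k \<in> {1..n}"
    and v: "v \<in> carrier_vec (2 ^ N)" and ws: "length ws = n" "set ws \<subseteq> carrier_vec 2"
  shows ctrl_U_ket0: "ws ! (k - 1) = ket 0 \<Longrightarrow>
      ctrl_U N n h b k *\<^sub>v kron_vecs (v # ws) = kron_vecs (v # ws)"
    and ctrl_U_ket1: "ws ! (k - 1) = ket 1 \<Longrightarrow>
      ctrl_U N n h b k *\<^sub>v kron_vecs (v # ws) =
      kron_vecs ((complex_of_real (sgn (h k)) \<cdot>\<^sub>m pauli_string N (b k) *\<^sub>v v) # ws)"
proof -
  let ?P = "complex_of_real (sgn (h k)) \<cdot>\<^sub>m pauli_string N (b k)"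
  have P: "?P \<in> carrier_mat (2 ^ N) (2 ^ N)" using pauli_string_carrier[of N "b k", OF b] by simp
  have I: "1\<^sub>m (2 ^ N) \<in> carrier_mat (2 ^ N) (2 ^ N)" by simp
  have sp: "ctrl_U N n h b k *\<^sub>v kron_vecs (v # ws) =
      on_branch n k 0 (1\<^sub>m (2 ^ N)) *\<^sub>v kron_vecs (v # ws) + on_branch n k 1 ?P *\<^sub>v kron_vecs (v # ws)"
    unfolding ctrl_U_def
    by (rule add_mult_distrib_mat_vec[OF on_branch_carrier[OF I] on_branch_carrier[OF P]
          kron_vecs_carrier[OF v ws]])
  have c1: "kron_vecs (v # ws) \<in> carrier_vec (2 ^ N * 2 ^ n)" by (rule kron_vecs_carrier[OF v ws])
  have c2: "kron_vecs ((?P *\<^sub>v v) # ws) \<in> carrier_vec (2 ^ N * 2 ^ n)"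
    by (rule kron_vecs_carrier[OF mult_mat_vec_carrier[OF P v] ws])
  show "ctrl_U N n h b k *\<^sub>v kron_vecs (v # ws) = kron_vecs (v # ws)" if "ws ! (k - 1) = ket 0"
  proof -
    have "on_branch n k 0 (1\<^sub>m (2 ^ N)) *\<^sub>v kron_vecs (v # ws) = kron_vecs (v # ws)"
      using on_branch_mult[OF I v ws k that, of 0] v by (simp del: kron_vecs_simps)
    moreover have "on_branch n k 1 ?P *\<^sub>v kron_vecs (v # ws) = 0\<^sub>v (2 ^ N * 2 ^ n)"
      using on_branch_mult[OF P v ws k that, of 1] by (simp del: kron_vecs_simps)
    ultimately show ?thesis unfolding sp by (simp only: right_zero_vec[OF c1])
  qed
  show "ctrl_U N n h b k *\<^sub>v kron_vecs (v # ws) = kron_vecs ((?P *\<^sub>v v) # ws)" if "ws ! (k - 1) = ket 1"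
  proof -
    have "on_branch n k 0 (1\<^sub>m (2 ^ N)) *\<^sub>v kron_vecs (v # ws) = 0\<^sub>v (2 ^ N * 2 ^ n)"
      using on_branch_mult[OF I v ws k that, of 0] by (simp del: kron_vecs_simps)
    moreover have "on_branch n k 1 ?P *\<^sub>v kron_vecs (v # ws) = kron_vecs ((?P *\<^sub>v v) # ws)"
      using on_branch_mult[OF P v ws k that, of 1] by (simp del: kron_vecs_simps)
    ultimately show ?thesis unfolding sp by (simp only: left_zero_vec[OF c2])
  qed
qed

lemma controlled_mult:
  assumes A: "A \<in> carrier_mat d d" and B: "B \<in> carrier_mat d d" and w: "w \<in> carrier_vec d"
  shows "(kron_mat A (ket_proj 0) + kron_mat B (ket_proj 1)) *\<^sub>v kron_vec w (ket 0) =
      kron_vec (A *\<^sub>v w) (ket 0)"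
    and "(kron_mat A (ket_proj 0) + kron_mat B (ket_proj 1)) *\<^sub>v kron_vec w (ket 1) =
      kron_vec (B *\<^sub>v w) (ket 1)"
proof -
  have K: "kron_mat A (ket_proj 0) \<in> carrier_mat (d * 2) (d * 2)"
    "kron_mat B (ket_proj 1) \<in> carrier_mat (d * 2) (d * 2)"
    using A B by (auto intro!: carrier_matI simp: ket_proj_def)
  have sp: "(kron_mat A (ket_proj 0) + kron_mat B (ket_proj 1)) *\<^sub>v kron_vec w (ket c) =
      kron_vec (A *\<^sub>v w) (ket_proj 0 *\<^sub>v ket c) + kron_vec (B *\<^sub>v w) (ket_proj 1 *\<^sub>v ket c)" for c
  proof -
    have "kron_vec w (ket c) \<in> carrier_vec (d * 2)" using w by (intro carrier_vecI) (simp add: ket_def)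
    then have "(kron_mat A (ket_proj 0) + kron_mat B (ket_proj 1)) *\<^sub>v kron_vec w (ket c) =
        kron_mat A (ket_proj 0) *\<^sub>v kron_vec w (ket c) + kron_mat B (ket_proj 1) *\<^sub>v kron_vec w (ket c)"
      by (rule add_mult_distrib_mat_vec[OF K])
    then show ?thesis using A B w by (simp add: kron_mat_mult_kron_vec ket_proj_def ket_def)
  qed
  have p: "ket_proj 0 *\<^sub>v ket 0 = ket 0" "ket_proj 1 *\<^sub>v ket 0 = 0\<^sub>v 2"
    "ket_proj 0 *\<^sub>v ket 1 = 0\<^sub>v 2" "ket_proj 1 *\<^sub>v ket 1 = ket 1"
    by (simp_all add: ket_proj_mult_ket)
  have d: "dim_vec (A *\<^sub>v w) = d" "dim_vec (B *\<^sub>v w) = d"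
    using A B by simp_all
  have c: "kron_vec (A *\<^sub>v w) (ket 0) \<in> carrier_vec (d * 2)" "kron_vec (B *\<^sub>v w) (ket 1) \<in> carrier_vec (d * 2)"
    by (rule carrier_vecI, simp only: kron_vec_dim d, simp add: ket_def)+
  show "(kron_mat A (ket_proj 0) + kron_mat B (ket_proj 1)) *\<^sub>v kron_vec w (ket 0) =
      kron_vec (A *\<^sub>v w) (ket 0)"
    unfolding sp p kron_vec_zero_right d by (rule right_zero_vec[OF c(1)])
  show "(kron_mat A (ket_proj 0) + kron_mat B (ket_proj 1)) *\<^sub>v kron_vec w (ket 1) =
      kron_vec (B *\<^sub>v w) (ket 1)"
    unfolding sp p kron_vec_zero_right d by (rule left_zero_vec[OF c(2)])
qed

lemma
  assumes b: "\<And>k i. k \<in> {1..n} \<Longrightarrow> i \<in> {1..N} \<Longrightarrow> b k i \<in> {0, 1, 2, 3}"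
    and w: "w \<in> carrier_vec (2 ^ N * 2 ^ n)"
  shows ctrl_V_ket0: "ctrl_V N n h b *\<^sub>v kron_vec w (ket 0) =
      kron_vec (mat_prod (2 ^ N * 2 ^ n) (map (ctrl_U N n h b) [1..<Suc n]) *\<^sub>v w) (ket 0)"
    and ctrl_V_ket1: "ctrl_V N n h b *\<^sub>v kron_vec w (ket 1) =
      kron_vec (mat_prod (2 ^ N * 2 ^ n) (map (ctrl_U N n h b) (rev [1..<Suc n])) *\<^sub>v w) (ket 1)"
proof -
  let ?d = "2 ^ N * 2 ^ n :: nat"
  have U: "ctrl_U N n h b k \<in> carrier_mat ?d ?d" if "k \<in> {1..n}" for k
    using b[OF that] by (rule ctrl_U_carrier)
  have prod: "mat_prod ?d (map (ctrl_U N n h b) ks) \<in> carrier_mat ?d ?d" if "set ks \<subseteq> {1..n}" for ks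
  proof (rule mat_prod_carrier)
    fix A assume "A \<in> set (map (ctrl_U N n h b) ks)"
    then obtain k where "k \<in> set ks" and A: "A = ctrl_U N n h b k" by auto
    then show "A \<in> carrier_mat ?d ?d" unfolding A using that by (intro U) blast
  qed
  have "set [1..<Suc n] \<subseteq> {1..n}" "set (rev [1..<Suc n]) \<subseteq> {1..n}" by auto
  note A = this[THEN prod]
  show "ctrl_V N n h b *\<^sub>v kron_vec w (ket 0) =
      kron_vec (mat_prod ?d (map (ctrl_U N n h b) [1..<Suc n]) *\<^sub>v w) (ket 0)"
    unfolding ctrl_V_def by (rule controlled_mult(1)[OF A w])
  show "ctrl_V N n h b *\<^sub>v kron_vec w (ket 1) =
      kron_vec (mat_prod ?d (map (ctrl_U N n h b) (rev [1..<Suc n])) *\<^sub>v w) (ket 1)"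
    unfolding ctrl_V_def by (rule controlled_mult(2)[OF A w])
qed

end

theory Submission
  imports Defs "HOL-Analysis.L2_Norm"
begin

text \<open>Put $Q_k = \mathrm{sgn}(h_k) P_k$, a Hermitian involution and hence an isometry. Expanding
  $\prod_k (2M + Q_k)$ for $n \le M$ factors, all terms except $(2M)^n$ have total norm at most
  $(2M+1)^n - (2M)^n \le (2M)^n$, because $(1 + 1/(2M))^n \le e^{1/2} \le 2$. So the real part of the
  quadratic form is nonnegative, with no appeal to the (anti)commutation of Pauli strings. In the
  circuit, pairing each control qubit with $|\phi\rangle$ replaces $U_k$ by
  $(2M + Q_k)/(2M+1)$, and the control qubit $C$ averages the two orders, which are
  adjoint to each other.\<close>

subsection \<open>Brackets and adjoints\<close>

text \<open>The gates entangle A with the control registers, so replacing U_k by the average (2M +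
  Q_k)/(2M+1) is not an operator identity on the whole space. It holds only inside a bracket whose
  bra carries |phi> on every register. The proof therefore follows product vectors: a gate turns a
  product vector into a sum of two product vectors, in which register k holds one of the two
  projections of |phi>. Each register meets one gate of the product, so its weight can be collected
  as a scalar at once. The weights 2M/(2M+1) and 1/(2M+1) are the squared amplitudes of |phi>; their
  ratio 2M is the shift in H_k, and their common denominator produces the factor (2M+1)^n. For
  positivity, Cauchy-Schwarz turns the norm bound on the non-leading terms into a bound on the
  quadratic form.\<close>

lemma braket_sum: "braket u v = (\<Sum>i<dim_vec u. cnj (u $ i) * v $ i)"
  unfolding braket_def scalar_prod_def
  by (auto simp: lessThan_atLeast0 mult.commute intro!: sum.cong)

lemma braket_add_right:
  assumes "u \<in> carrier_vec d" "v \<in> carrier_vec d" "w \<in> carrier_vec d"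
  shows "braket u (v + w) = braket u v + braket u w"
  using assms by (simp add: braket_sum algebra_simps sum.distrib)

lemma braket_smult_right:
  assumes "u \<in> carrier_vec d" "v \<in> carrier_vec d"
  shows "braket u (c \<cdot>\<^sub>v v) = c * braket u v"
  using assms by (simp add: braket_sum sum_distrib_left algebra_simps)

lemma braket_cnj:
  assumes "u \<in> carrier_vec d" "v \<in> carrier_vec d"
  shows "cnj (braket u v) = braket v u"
  using assms by (simp add: braket_sum mult.commute)

lemma mat_adjoint_dim [simp]: "dim_row (mat_adjoint A) = dim_col A"
  "dim_col (mat_adjoint A) = dim_row A"
  by (simp_all add: mat_adjoint_def)

lemma mat_adjoint_index:
  fixes A :: "complex mat"
  assumes "i < dim_col A" "j < dim_row A"
  shows "mat_adjoint A $$ (i, j) = cnj (A $$ (j, i))"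
  using assms by (simp add: mat_adjoint_def mat_of_rows_index)

lemma mat_adjoint_add:
  fixes A B :: "complex mat"
  assumes "A \<in> carrier_mat m n" "B \<in> carrier_mat m n"
  shows "mat_adjoint (A + B) = mat_adjoint A + mat_adjoint B"
  using assms by (intro eq_matI) (auto simp: mat_adjoint_index)

lemma mat_adjoint_smult:
  fixes A :: "complex mat"
  shows "mat_adjoint (c \<cdot>\<^sub>m A) = cnj c \<cdot>\<^sub>m mat_adjoint A"
  by (intro eq_matI) (auto simp: mat_adjoint_index)

lemma mat_adjoint_one: "mat_adjoint (1\<^sub>m d :: complex mat) = 1\<^sub>m d"
  by (intro eq_matI) (auto simp: mat_adjoint_index)

lemma mat_adjoint_mult:
  fixes A B :: "complex mat"
  assumes "A \<in> carrier_mat l m" "B \<in> carrier_mat m n"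
  shows "mat_adjoint (A * B) = mat_adjoint B * mat_adjoint A"
  using assms
  by (intro eq_matI) (auto simp: mat_adjoint_index scalar_prod_def mult.commute intro!: sum.cong)

lemma braket_mat_adjoint:
  assumes A: "A \<in> carrier_mat m n" and u: "u \<in> carrier_vec m" and v: "v \<in> carrier_vec n"
  shows "braket u (A *\<^sub>v v) = braket (mat_adjoint A *\<^sub>v u) v"
proof -
  have "braket u (A *\<^sub>v v) = (\<Sum>i<m. \<Sum>j<n. cnj (u $ i) * (A $$ (i, j) * v $ j))"
    using assms by (auto simp: braket_sum scalar_prod_def sum_distrib_left lessThan_atLeast0 intro!: sum.cong)
  also have "\<dots> = (\<Sum>j<n. \<Sum>i<m. cnj (u $ i) * (A $$ (i, j) * v $ j))"
    by (rule sum.swap)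
  also have "\<dots> = braket (mat_adjoint A *\<^sub>v u) v"
    using assms by (auto simp: braket_sum scalar_prod_def sum_distrib_left lessThan_atLeast0
        mat_adjoint_index ac_simps intro!: sum.cong)
  finally show ?thesis .
qed

subsection \<open>Ordered products\<close>

lemma mat_prod_simps [simp]: "mat_prod d [] = 1\<^sub>m d" "mat_prod d (A # As) = A * mat_prod d As"
  by (simp_all add: mat_prod_def)

lemma mat_prod_append:
  assumes "set As \<subseteq> carrier_mat d d" "set Bs \<subseteq> carrier_mat d d"
  shows "mat_prod d (As @ Bs) = mat_prod d As * mat_prod d Bs"
  using assms(1)
proof (induction As)
  case Nil
  have "mat_prod d Bs \<in> carrier_mat d d" using assms(2) by (intro mat_prod_carrier) blast
  then show ?case by simp
next
  case (Cons A As)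
  have "mat_prod d Bs \<in> carrier_mat d d" using assms(2) by (intro mat_prod_carrier) blast
  moreover have "mat_prod d As \<in> carrier_mat d d" using Cons.prems by (intro mat_prod_carrier) auto
  ultimately show ?case using Cons by (simp add: assoc_mult_mat[of _ d d _ d _ d])
qed

lemma mat_prod_snoc:
  assumes "set As \<subseteq> carrier_mat d d" "A \<in> carrier_mat d d"
  shows "mat_prod d (As @ [A]) = mat_prod d As * A"
  using assms by (simp add: mat_prod_append)

text \<open>This separates the scalars |h_k| from the operators, so that all later work concerns the
  shifted involutions 2M + Q_k.\<close>

lemma mat_prod_smult:
  assumes "\<And>k. k \<in> set ks \<Longrightarrow> A k \<in> carrier_mat d d"
  shows "mat_prod d (map (\<lambda>k. c k \<cdot>\<^sub>m A k) ks) = prod_list (map c ks) \<cdot>\<^sub>m mat_prod d (map A ks)"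
  using assms
proof (induction ks)
  case Nil
  then show ?case by (intro eq_matI) auto
next
  case (Cons k ks)
  have "mat_prod d (map A ks) \<in> carrier_mat d d" using Cons.prems by (intro mat_prod_carrier) auto
  moreover have "x \<cdot>\<^sub>m (y \<cdot>\<^sub>m X) = (x * y) \<cdot>\<^sub>m X" for x y :: complex and X
    by (intro eq_matI) auto
  ultimately show ?case
    using Cons by (simp add: mult_smult_assoc_mat[of _ d d _ d] mult_smult_distrib[of _ d d _ d] ac_simps)
qed

text \<open>The adjoint reverses a product and fixes each Hermitian factor. Hence the two operator
  orders of the theorem are adjoint to each other, which yields both the Hermiticity of their sum
  and the real part in the circuit formula.\<close>

lemma mat_adjoint_mat_prod:
  assumes "\<And>k. k \<in> set ks \<Longrightarrow> A k \<in> carrier_mat d d \<and> hermitian_mat (A k)"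
  shows "mat_adjoint (mat_prod d (map A ks)) = mat_prod d (map A (rev ks))"
  using assms
proof (induction ks)
  case Nil
  then show ?case by (simp add: mat_adjoint_one)
next
  case (Cons k ks)
  have "mat_prod d (map A ks) \<in> carrier_mat d d" using Cons.prems by (intro mat_prod_carrier) auto
  moreover have "set (map A (rev ks)) \<subseteq> carrier_mat d d" "A k \<in> carrier_mat d d"
    "mat_adjoint (A k) = A k" using Cons.prems by (auto simp: hermitian_mat_def)
  ultimately show ?case
    using Cons mat_prod_snoc[of "map A (rev ks)" d "A k"] by (simp add: mat_adjoint_mult[of _ d d _ d])
qed

subsection \<open>The Euclidean norm\<close>

text \<open>Written through \<open>L2_set\<close> so that the triangle and Cauchy-Schwarz
  inequalities are inherited from it.\<close>

definition vnorm :: "complex vec \<Rightarrow> real" where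
  "vnorm v = L2_set (\<lambda>i. cmod (v $ i)) {..<dim_vec v}"

lemma vnorm_nonneg: "0 \<le> vnorm v"
  by (simp add: vnorm_def)

lemma braket_self: "braket v v = complex_of_real ((vnorm v)\<^sup>2)"
proof -
  have "braket v v = (\<Sum>i<dim_vec v. complex_of_real ((cmod (v $ i))\<^sup>2))"
    unfolding braket_sum by (intro sum.cong refl) (metis complex_norm_square mult.commute of_real_power)
  also have "\<dots> = complex_of_real ((vnorm v)\<^sup>2)"
    by (simp add: vnorm_def L2_set_def sum_nonneg)
  finally show ?thesis .
qed

lemma vnorm_triangle:
  assumes "u \<in> carrier_vec d" "v \<in> carrier_vec d"
  shows "vnorm (u + v) \<le> vnorm u + vnorm v"
proof -
  have "vnorm (u + v) \<le> L2_set (\<lambda>i. cmod (u $ i) + cmod (v $ i)) {..<d}"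
    using assms by (auto simp: vnorm_def intro!: L2_set_mono norm_triangle_ineq)
  also have "\<dots> \<le> vnorm u + vnorm v"
    using assms L2_set_triangle_ineq[of "\<lambda>i. cmod (u $ i)" "\<lambda>i. cmod (v $ i)" "{..<d}"]
    by (simp add: vnorm_def)
  finally show ?thesis .
qed

lemma vnorm_smult: "vnorm (c \<cdot>\<^sub>v v) = cmod c * vnorm v"
  by (simp add: vnorm_def L2_set_right_distrib) (auto simp: norm_mult intro!: L2_set_cong)

lemma cmod_braket_le:
  assumes "u \<in> carrier_vec d" "v \<in> carrier_vec d"
  shows "cmod (braket u v) \<le> vnorm u * vnorm v"
proof -
  have "cmod (braket u v) \<le> (\<Sum>i<d. \<bar>cmod (u $ i)\<bar> * \<bar>cmod (v $ i)\<bar>)"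
    unfolding braket_sum using assms by (auto simp: norm_mult intro!: sum_norm_le)
  also have "\<dots> \<le> vnorm u * vnorm v"
    using assms L2_set_mult_ineq[of "\<lambda>i. cmod (u $ i)" "\<lambda>i. cmod (v $ i)" "{..<d}"]
    by (simp add: vnorm_def)
  finally show ?thesis .
qed

text \<open>Moving one factor across the bracket gives <Av, Av> = <AAv, v> = <v, v>.\<close>

lemma vnorm_hermitian_involution:
  assumes A: "A \<in> carrier_mat d d" "hermitian_mat A" "A * A = 1\<^sub>m d" and v: "v \<in> carrier_vec d"
  shows "vnorm (A *\<^sub>v v) = vnorm v"
proof -
  have "braket (A *\<^sub>v v) (A *\<^sub>v v) = braket (A *\<^sub>v (A *\<^sub>v v)) v"
    using braket_mat_adjoint[of A d d "A *\<^sub>v v" v] A v by (simp add: hermitian_mat_def)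
  also have "A *\<^sub>v (A *\<^sub>v v) = v"
    using A v by (simp add: assoc_mult_mat_vec[symmetric])
  finally have "(vnorm (A *\<^sub>v v))\<^sup>2 = (vnorm v)\<^sup>2"
    unfolding braket_self of_real_eq_iff .
  then show ?thesis by (simp add: vnorm_nonneg)
qed

text \<open>Induction on the leftmost factor, which acts last. Applying A + s to s^l v + e leaves
  s^(l+1) v plus a new error, and since A preserves norms the error coefficient obeys c_(l+1) = s^l
  + (s+1) c_l with c_0 = 0. The solution is c_l = (s+1)^l - s^l. The error is kept as a vector
  \<open>e\<close> because the factors need not commute and have no convenient closed
  expansion.\<close>

lemma vnorm_shifted_prod_diff_le:
  fixes s :: real
  assumes A: "\<And>k. k \<in> set ks \<Longrightarrow> A k \<in> carrier_mat d d"
    and iso: "\<And>k v. k \<in> set ks \<Longrightarrow> v \<in> carrier_vec d \<Longrightarrow> vnorm (A k *\<^sub>v v) = vnorm v"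
    and s: "0 \<le> s" and v: "v \<in> carrier_vec d"
  shows "\<exists>e \<in> carrier_vec d.
    mat_prod d (map (\<lambda>k. A k + complex_of_real s \<cdot>\<^sub>m 1\<^sub>m d) ks) *\<^sub>v v
      = complex_of_real (s ^ length ks) \<cdot>\<^sub>v v + e \<and>
    vnorm e \<le> ((s + 1) ^ length ks - s ^ length ks) * vnorm v"
  using A iso
proof (induction ks)
  case Nil
  then show ?case using v by (intro bexI[of _ "0\<^sub>v d"]) (auto simp: vnorm_def L2_set_def)
next
  case (Cons k ks)
  let ?R = "mat_prod d (map (\<lambda>k. A k + complex_of_real s \<cdot>\<^sub>m 1\<^sub>m d) ks)"
  let ?l = "length ks"
  have Ak: "A k \<in> carrier_mat d d"
    and isok: "\<And>v. v \<in> carrier_vec d \<Longrightarrow> vnorm (A k *\<^sub>v v) = vnorm v" using Cons.prems by auto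
  have R: "?R \<in> carrier_mat d d" using Cons.prems by (intro mat_prod_carrier) auto
  obtain e where e: "e \<in> carrier_vec d" "?R *\<^sub>v v = complex_of_real (s ^ ?l) \<cdot>\<^sub>v v + e"
    and le: "vnorm e \<le> ((s + 1) ^ ?l - s ^ ?l) * vnorm v"
    using Cons by auto
  \<comment> \<open>Everything in (A k + s)(s^l v + e) other than s^(l+1) v.\<close>
  let ?e' = "complex_of_real (s ^ ?l) \<cdot>\<^sub>v (A k *\<^sub>v v) + (A k *\<^sub>v e + complex_of_real s \<cdot>\<^sub>v e)"
  have Av: "A k *\<^sub>v v \<in> carrier_vec d" "A k *\<^sub>v e \<in> carrier_vec d" using Ak v e by auto
  have I: "A k + complex_of_real s \<cdot>\<^sub>m 1\<^sub>m d \<in> carrier_mat d d" using Ak by simp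
  have sm: "(complex_of_real s \<cdot>\<^sub>m 1\<^sub>m d) *\<^sub>v x = complex_of_real s \<cdot>\<^sub>v x" if "x \<in> carrier_vec d" for x
    using that by (intro eq_vecI) auto
  have "((A k + complex_of_real s \<cdot>\<^sub>m 1\<^sub>m d) * ?R) *\<^sub>v v
      = (A k + complex_of_real s \<cdot>\<^sub>m 1\<^sub>m d) *\<^sub>v (complex_of_real (s ^ ?l) \<cdot>\<^sub>v v + e)"
    unfolding assoc_mult_mat_vec[OF I R v] e(2) ..
  also have "\<dots> = A k *\<^sub>v (complex_of_real (s ^ ?l) \<cdot>\<^sub>v v + e)
      + complex_of_real s \<cdot>\<^sub>v (complex_of_real (s ^ ?l) \<cdot>\<^sub>v v + e)"
    using Ak v e(1) by (subst add_mult_distrib_mat_vec[of _ d d]) (simp_all add: sm)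
  also have "A k *\<^sub>v (complex_of_real (s ^ ?l) \<cdot>\<^sub>v v + e)
      = complex_of_real (s ^ ?l) \<cdot>\<^sub>v (A k *\<^sub>v v) + A k *\<^sub>v e"
    using Ak v e(1) by (simp add: mult_add_distrib_mat_vec[of _ d d] mult_mat_vec[of _ d d])
  also have "complex_of_real (s ^ ?l) \<cdot>\<^sub>v (A k *\<^sub>v v) + A k *\<^sub>v e
      + complex_of_real s \<cdot>\<^sub>v (complex_of_real (s ^ ?l) \<cdot>\<^sub>v v + e)
      = complex_of_real (s ^ Suc ?l) \<cdot>\<^sub>v v + ?e'"
    using Ak v e(1) by (intro eq_vecI) (auto simp: algebra_simps)
  finally have eq: "((A k + complex_of_real s \<cdot>\<^sub>m 1\<^sub>m d) * ?R) *\<^sub>v v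
      = complex_of_real (s ^ Suc ?l) \<cdot>\<^sub>v v + ?e'" .
  have "vnorm ?e' \<le> vnorm (complex_of_real (s ^ ?l) \<cdot>\<^sub>v (A k *\<^sub>v v))
      + vnorm (A k *\<^sub>v e + complex_of_real s \<cdot>\<^sub>v e)"
    using Av e by (intro vnorm_triangle[of _ d]) auto
  also have "vnorm (A k *\<^sub>v e + complex_of_real s \<cdot>\<^sub>v e)
      \<le> vnorm (A k *\<^sub>v e) + vnorm (complex_of_real s \<cdot>\<^sub>v e)"
    using Av e by (intro vnorm_triangle[of _ d]) auto
  finally have "vnorm ?e' \<le> s ^ ?l * vnorm v + (1 + s) * vnorm e"
    using s v e by (simp add: vnorm_smult isok norm_power algebra_simps)
  also have "\<dots> \<le> s ^ ?l * vnorm v + (1 + s) * (((s + 1) ^ ?l - s ^ ?l) * vnorm v)"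
    using le s by (intro add_left_mono mult_left_mono) auto
  also have "\<dots> = ((s + 1) ^ Suc ?l - s ^ Suc ?l) * vnorm v"
    by (simp add: algebra_simps)
  finally show ?case
    using eq Av e by (intro bexI[of _ ?e']) auto
qed

section \<open>Scalar estimate and positivity of the quadratic form\<close>

lemma odd_power_le_twice_even_power:
  fixes M n :: nat
  assumes "1 \<le> M" "n \<le> M"
  shows "(2 * real M + 1) ^ n \<le> 2 * (2 * real M) ^ n"
proof -
  have "(1 + 1 / (2 * real M)) ^ n \<le> exp (1 / (2 * real M)) ^ n"
    using exp_ge_add_one_self by (intro power_mono) auto
  also have "\<dots> = exp (real n / (2 * real M))"
    by (simp flip: exp_of_nat_mult)
  \<comment> \<open>Here \<open>n \<le> M\<close> enters: it gives n/(2M) \<le> 1/2.\<close>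
  also have "\<dots> \<le> exp (1 / 2)"
    using assms by (simp add: field_simps)
  also have "\<dots> \<le> 2" using exp_bound_half[of "1/2 :: real"] by simp
  finally have "(1 + 1 / (2 * real M)) ^ n * (2 * real M) ^ n \<le> 2 * (2 * real M) ^ n"
    by (intro mult_right_mono) auto
  moreover have "(1 + 1 / (2 * real M)) * (2 * real M) = 2 * real M + 1"
    using assms by (simp add: field_simps)
  ultimately show ?thesis by (metis power_mult_distrib)
qed

text \<open>With l factors and error vector e, the real part is at least (2M)^l |v|^2 - |v| |e| by
  Cauchy-Schwarz, and |e| \<le> (2M)^l |v|.\<close>

lemma Re_braket_shifted_prod_nonneg:
  fixes M :: nat
  assumes A: "\<And>k. k \<in> set ks \<Longrightarrow> A k \<in> carrier_mat d d"
    and iso: "\<And>k v. k \<in> set ks \<Longrightarrow> v \<in> carrier_vec d \<Longrightarrow> vnorm (A k *\<^sub>v v) = vnorm v"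
    and M: "1 \<le> M" "length ks \<le> M" and v: "v \<in> carrier_vec d"
  shows "0 \<le> Re (braket v
    (mat_prod d (map (\<lambda>k. A k + complex_of_real (2 * real M) \<cdot>\<^sub>m 1\<^sub>m d) ks) *\<^sub>v v))"
proof -
  let ?l = "length ks"
  obtain e where e: "e \<in> carrier_vec d"
    "mat_prod d (map (\<lambda>k. A k + complex_of_real (2 * real M) \<cdot>\<^sub>m 1\<^sub>m d) ks) *\<^sub>v v
      = complex_of_real ((2 * real M) ^ ?l) \<cdot>\<^sub>v v + e"
    and le: "vnorm e \<le> ((2 * real M + 1) ^ ?l - (2 * real M) ^ ?l) * vnorm v"
    using vnorm_shifted_prod_diff_le[of ks A d "2 * real M" v] A iso v by auto
  have "Re (braket v (complex_of_real ((2 * real M) ^ ?l) \<cdot>\<^sub>v v + e))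
      = (2 * real M) ^ ?l * (vnorm v)\<^sup>2 + Re (braket v e)"
    using v e
    by (simp add: braket_add_right[of _ d] braket_smult_right[of _ d] braket_self flip: of_real_power of_real_mult)
  moreover have "\<bar>Re (braket v e)\<bar> \<le> vnorm v * vnorm e"
    using abs_Re_le_cmod cmod_braket_le[OF v e(1)] order_trans by blast
  moreover have "vnorm v * vnorm e \<le> vnorm v * ((2 * real M) ^ ?l * vnorm v)"
  proof (intro mult_left_mono vnorm_nonneg)
    \<comment> \<open>The factor 2 in the scalar estimate is exactly what makes the error
      coefficient no larger than the leading one.\<close>
    have "((2 * real M + 1) ^ ?l - (2 * real M) ^ ?l) * vnorm v \<le> (2 * real M) ^ ?l * vnorm v"
      using odd_power_le_twice_even_power[OF M] by (intro mult_right_mono vnorm_nonneg) linarith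
    with le show "vnorm e \<le> (2 * real M) ^ ?l * vnorm v" by simp
  qed
  ultimately show ?thesis unfolding e(2) by (simp add: power2_eq_square algebra_simps)
qed

subsection \<open>Kronecker products\<close>

text \<open>The contracted index of a product space splits into quotient and remainder, so the sum
  over it factors by \<open>sum_prod_index\<close>.\<close>

lemma kron_mat_mult:
  assumes "dim_col A = dim_row C" "dim_col B = dim_row D"
  shows "kron_mat A B * kron_mat C D = kron_mat (A * C) (B * D)"
proof (rule eq_matI)
  fix i j assume "i < dim_row (kron_mat (A * C) (B * D))" "j < dim_col (kron_mat (A * C) (B * D))"
  then have i: "i < dim_row A * dim_row B" and j: "j < dim_col C * dim_col D" by simp_all
  then have pos: "dim_row B > 0" "dim_col D > 0" by (auto intro: gr0I)
  have d: "i div dim_row B < dim_row A" "j div dim_col D < dim_col C"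
    using i j by (simp_all add: less_mult_imp_div_less)
  have m: "i mod dim_row B < dim_row B" "j mod dim_col D < dim_col D" using pos by simp_all
  have "(kron_mat A B * kron_mat C D) $$ (i, j) =
      (\<Sum>l<dim_row C * dim_row D.
         (A $$ (i div dim_row B, l div dim_row D) * C $$ (l div dim_row D, j div dim_col D)) *
         (B $$ (i mod dim_row B, l mod dim_row D) * D $$ (l mod dim_row D, j mod dim_col D)))"
    using i j assms by (auto simp: scalar_prod_def kron_mat_def lessThan_atLeast0 intro!: sum.cong)
  also have "\<dots> = (\<Sum>l<dim_row C. A $$ (i div dim_row B, l) * C $$ (l, j div dim_col D)) *
      (\<Sum>l<dim_row D. B $$ (i mod dim_row B, l) * D $$ (l, j mod dim_col D))"
    by (rule sum_prod_index)
  also have "\<dots> = (A * C) $$ (i div dim_row B, j div dim_col D) *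
      (B * D) $$ (i mod dim_row B, j mod dim_col D)"
    using d m assms
    by (auto simp: scalar_prod_def lessThan_atLeast0 intro!: arg_cong2[where f = "(*)"] sum.cong)
  also have "\<dots> = kron_mat (A * C) (B * D) $$ (i, j)"
    using i j by (simp add: kron_mat_def)
  finally show "(kron_mat A B * kron_mat C D) $$ (i, j) = kron_mat (A * C) (B * D) $$ (i, j)" .
qed simp_all

lemma mat_adjoint_kron_mat: "mat_adjoint (kron_mat A B) = kron_mat (mat_adjoint A) (mat_adjoint B)"
proof (rule eq_matI)
  fix i j assume "i < dim_row (kron_mat (mat_adjoint A) (mat_adjoint B))"
    "j < dim_col (kron_mat (mat_adjoint A) (mat_adjoint B))"
  then have i: "i < dim_col A * dim_col B" and j: "j < dim_row A * dim_row B" by simp_all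
  then have pos: "dim_col B > 0" "dim_row B > 0" by (auto intro: gr0I)
  then show "mat_adjoint (kron_mat A B) $$ (i, j) = kron_mat (mat_adjoint A) (mat_adjoint B) $$ (i, j)"
    using i j by (simp add: mat_adjoint_index kron_mat_def less_mult_imp_div_less)
qed simp_all

lemma kron_mat_one: "kron_mat (1\<^sub>m a) (1\<^sub>m b) = 1\<^sub>m (a * b)"
proof (rule eq_matI)
  fix i j assume "i < dim_row (1\<^sub>m (a * b) :: complex mat)" "j < dim_col (1\<^sub>m (a * b) :: complex mat)"
  then have ij: "i < a * b" "j < a * b" by simp_all
  then have "b > 0" by (auto intro: gr0I)
  \<comment> \<open>Quotient and remainder together determine the index, so the product of the two
    Kronecker deltas is the delta on pairs.\<close>
  moreover have "i = j \<longleftrightarrow> i div b = j div b \<and> i mod b = j mod b"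
    by (metis div_mult_mod_eq)
  ultimately show "kron_mat (1\<^sub>m a) (1\<^sub>m b) $$ (i, j) = 1\<^sub>m (a * b) $$ (i, j)"
    using ij by (auto simp: kron_mat_def less_mult_imp_div_less)
qed simp_all

text \<open>Both properties pass to tensor products: adjoints act factorwise, and squares do so by
  the mixed-product rule.\<close>

lemma kron_mats_hermitian_involution:
  assumes "\<And>A. A \<in> set As \<Longrightarrow> hermitian_mat A \<and> A * A = 1\<^sub>m (dim_row A)"
  shows "hermitian_mat (kron_mats As) \<and>
    kron_mats As * kron_mats As = 1\<^sub>m (dim_row (kron_mats As))"
  using assms
proof (induction As)
  case Nil
  then show ?case by (simp add: hermitian_mat_def mat_adjoint_one)
next
  case (Cons A As)
  then show ?case
    by (simp add: hermitian_mat_def mat_adjoint_kron_mat kron_mat_mult kron_mat_one)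
qed

lemma pauli_hermitian_involution:
  assumes "c \<in> {0, 1, 2, 3}"
  shows "hermitian_mat (pauli c) \<and> pauli c * pauli c = 1\<^sub>m (dim_row (pauli c))"
proof -
  \<comment> \<open>Splits an index below 2 into its two values, which reduces the claim to a check
    of the four entries of each Pauli matrix.\<close>
  have less2: "i < Suc (Suc 0) \<longleftrightarrow> i = 0 \<or> i = Suc 0" for i :: nat by auto
  show ?thesis
    using assms unfolding hermitian_mat_def
    by (auto simp: pauli_def mat_of_rows_list_def mat_adjoint_index less2 scalar_prod_def
        mat_adjoint_one numeral_2_eq_2 numeral_3_eq_3 intro!: eq_matI)
qed

lemma pauli_string_hermitian_involution:
  assumes "\<And>i. i \<in> {1..N} \<Longrightarrow> b i \<in> {0, 1, 2, 3}"
  shows "hermitian_mat (pauli_string N b)" "pauli_string N b * pauli_string N b = 1\<^sub>m (2 ^ N)"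
proof -
  have "hermitian_mat A \<and> A * A = 1\<^sub>m (dim_row A)"
    if A: "A \<in> set (map (\<lambda>i. pauli (b i)) [1..<Suc N])" for A
  proof -
    have "A \<in> (\<lambda>i. pauli (b i)) ` {1..N}"
      using A by (simp add: atLeastLessThanSuc_atLeastAtMost del: upt_Suc)
    then obtain i where "i \<in> {1..N}" "A = pauli (b i)" by blast
    then show ?thesis using assms pauli_hermitian_involution by blast
  qed
  from kron_mats_hermitian_involution[of "map (\<lambda>i. pauli (b i)) [1..<Suc N]", OF this]
  have *: "hermitian_mat (pauli_string N b)"
    "pauli_string N b * pauli_string N b = 1\<^sub>m (dim_row (pauli_string N b))"
    unfolding pauli_string_def by blast+
  show "hermitian_mat (pauli_string N b)" by (fact *(1))
  have "dim_row (pauli_string N b) = 2 ^ N"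
    using pauli_string_carrier[of N b, OF assms] by blast
  then show "pauli_string N b * pauli_string N b = 1\<^sub>m (2 ^ N)" using *(2) by (simp only:)
qed

section \<open>Product vectors: factorised brackets and regrouping\<close>

lemma braket_kron_vec:
  assumes "dim_vec u = dim_vec v" "dim_vec u' = dim_vec v'"
  shows "braket (kron_vec u u') (kron_vec v v') = braket u v * braket u' v'"
proof -
  have "braket (kron_vec u u') (kron_vec v v') =
      (\<Sum>i<dim_vec u * dim_vec u'. (cnj (u $ (i div dim_vec u')) * v $ (i div dim_vec u')) *
         (cnj (u' $ (i mod dim_vec u')) * v' $ (i mod dim_vec u')))"
    using assms unfolding braket_sum by (auto simp: kron_vec_def intro!: sum.cong)
  also have "\<dots> = braket u v * braket u' v'"
    unfolding braket_sum by (rule sum_prod_index)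
  finally show ?thesis .
qed

lemma braket_kron_vecs:
  assumes "list_all2 (\<lambda>u v. dim_vec u = dim_vec v) us vs"
  shows "braket (kron_vecs us) (kron_vecs vs) = prod_list (map2 braket us vs)"
  using assms
proof induction
  case Nil
  then show ?case by (simp add: braket_sum)
next
  case (Cons u us v vs)
  have "dim_vec (kron_vecs us) = dim_vec (kron_vecs vs)"
    using Cons(2) by induction auto
  with Cons show ?case by (simp add: braket_kron_vec)
qed

text \<open>Both sides read the same three digits of i in the mixed radix given by the dimensions.
  Associativity is what allows the last tensor factor C to be split off, although
  \<open>kron_vecs\<close> nests to the right.\<close>

lemma kron_vec_assoc: "kron_vec (kron_vec u v) w = kron_vec u (kron_vec v w)"
proof (rule eq_vecI)
  fix i assume "i < dim_vec (kron_vec u (kron_vec v w))"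
  then have i: "i < dim_vec u * dim_vec v * dim_vec w" by (simp add: mult.assoc)
  then have pos: "dim_vec v > 0" "dim_vec w > 0" by (auto intro: gr0I)
  have "i div dim_vec w div dim_vec v = i div (dim_vec v * dim_vec w)"
    by (metis div_mult2_eq mult.commute)
  moreover have "i div dim_vec w mod dim_vec v = i mod (dim_vec v * dim_vec w) div dim_vec w"
  proof -
    \<comment> \<open>The two lowest digits, with the digit for w least significant; division by
      \<open>dim_vec w\<close> then leaves the middle digit.\<close>
    have e: "i mod (dim_vec v * dim_vec w) = dim_vec w * (i div dim_vec w mod dim_vec v) + i mod dim_vec w"
      by (metis mod_mult2_eq mult.commute)
    show ?thesis
      unfolding e using pos by (subst div_mult_self4) (auto simp: mod_less_divisor[THEN div_less])
  qed
  moreover have "i mod (dim_vec v * dim_vec w) mod dim_vec w = i mod dim_vec w"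
    by (rule mod_mod_cancel) simp
  ultimately show "kron_vec (kron_vec u v) w $ i = kron_vec u (kron_vec v w) $ i"
    using i pos by (simp add: kron_vec_def less_mult_imp_div_less mult.assoc)
qed simp

lemma kron_vec_one_left: "kron_vec (vec 1 (\<lambda>_. 1)) v = v"
  by (rule eq_vecI) (auto simp: kron_vec_def)

lemma kron_vec_one_right: "kron_vec v (vec 1 (\<lambda>_. 1)) = v"
  by (rule eq_vecI) (auto simp: kron_vec_def)

lemma kron_vecs_snoc: "kron_vecs (vs @ [w]) = kron_vec (kron_vecs vs) w"
  by (induction vs) (simp_all only: append.simps kron_vecs_simps kron_vec_one_left kron_vec_one_right kron_vec_assoc)

lemma kron_vec_add_right:
  assumes "dim_vec v = dim_vec w"
  shows "kron_vec u (v + w) = kron_vec u v + kron_vec u w"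
proof (rule eq_vecI)
  fix i assume "i < dim_vec (kron_vec u v + kron_vec u w)"
  then have i: "i < dim_vec u * dim_vec w" by simp
  then have "dim_vec w > 0" by (auto intro: gr0I)
  with i assms show "kron_vec u (v + w) $ i = (kron_vec u v + kron_vec u w) $ i"
    by (simp add: kron_vec_def algebra_simps)
qed (use assms in simp)

lemma kron_vec_smult_right: "kron_vec u (c \<cdot>\<^sub>v v) = c \<cdot>\<^sub>v kron_vec u v"
proof (rule eq_vecI)
  fix i assume "i < dim_vec (c \<cdot>\<^sub>v kron_vec u v)"
  then have i: "i < dim_vec u * dim_vec v" by simp
  then have "dim_vec v > 0" by (auto intro: gr0I)
  with i show "kron_vec u (c \<cdot>\<^sub>v v) $ i = (c \<cdot>\<^sub>v kron_vec u v) $ i"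
    by (simp add: kron_vec_def)
qed simp

subsection \<open>The circuit\<close>

text \<open>Register k may hold any vector, in contrast to \<open>on_branch_mult\<close>, which
  expects a basis vector there. The circuit needs this because its registers start in the
  superposition |phi>. The result is again a single product vector.\<close>

lemma on_branch_mult_kron_vecs:
  assumes X: "X \<in> carrier_mat (2 ^ N) (2 ^ N)" and v: "v \<in> carrier_vec (2 ^ N)"
    and ws: "length ws = n" "set ws \<subseteq> carrier_vec 2" and k: "k \<in> {1..n}"
  shows "on_branch n k c X *\<^sub>v kron_vecs (v # ws) =
    kron_vecs ((X *\<^sub>v v) # ws[k - 1 := ket_proj c *\<^sub>v ws ! (k - 1)])"
proof -
  let ?B = "map (\<lambda>j. if j = k then ket_proj c else 1\<^sub>m 2) [1..<Suc n]"
  have wsi: "ws ! i \<in> carrier_vec 2" if "i < n" for i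
    using ws that by (metis nth_mem subsetD)
  have Bi: "?B ! i = (if Suc i = k then ket_proj c else 1\<^sub>m 2)" if "i < n" for i
    using that by (auto simp del: upt_Suc)
  have la: "list_all2 (\<lambda>A v. dim_vec v = dim_col A) (X # ?B) (v # ws)"
    using X v ws wsi Bi
    by (auto simp: list_all2_conv_all_nth ket_proj_def nth_Cons simp del: upt_Suc split: nat.split)
  have "map2 (*\<^sub>v) ?B ws = ws[k - 1 := ket_proj c *\<^sub>v ws ! (k - 1)]"
  proof (rule nth_equalityI)
    fix i assume "i < length (map2 (*\<^sub>v) ?B ws)"
    then have i: "i < n" using ws by (simp del: upt_Suc)
    then have "map2 (*\<^sub>v) ?B ws ! i = ?B ! i *\<^sub>v ws ! i"
      using ws by (simp del: upt_Suc)
    also have "\<dots> = ws[k - 1 := ket_proj c *\<^sub>v ws ! (k - 1)] ! i"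
      unfolding Bi[OF i] using i k ws(1) wsi[OF i] by (auto simp: nth_list_update)
    finally show "map2 (*\<^sub>v) ?B ws ! i = ws[k - 1 := ket_proj c *\<^sub>v ws ! (k - 1)] ! i" .
  qed (use ws in \<open>simp del: upt_Suc\<close>)
  then show ?thesis
    unfolding on_branch_def using kron_mats_mult_kron_vecs[OF la]
    by (simp del: upt_Suc kron_mats_simps kron_vecs_simps)
qed

text \<open>The overwritten entry contributed the factor 1, so the update costs one multiplication
  and no division. In the circuit f pairs with |phi>, and that factor is <phi|phi> = 1.\<close>

lemma prod_list_map_update:
  fixes f :: "'a \<Rightarrow> 'b::comm_monoid_mult"
  assumes "i < length xs" "f (xs ! i) = 1"
  shows "prod_list (map f (xs[i := x])) = f x * prod_list (map f xs)"
  using assms by (induction xs arbitrary: i) (auto simp: nth_Cons ac_simps split: nat.splits)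

lemma ket_phi_carrier: "ket_phi M \<in> carrier_vec 2"
  by (auto simp: ket_phi_def ket_def)

lemma braket_ket_phi:
  "braket (ket_phi M) (ket_proj 0 *\<^sub>v ket_phi M) = complex_of_real (2 * real M / (2 * real M + 1))"
  "braket (ket_phi M) (ket_proj 1 *\<^sub>v ket_phi M) = complex_of_real (1 / (2 * real M + 1))"
  "braket (ket_phi M) (ket_phi M) = 1"
proof -
  let ?p = "sqrt (2 * real M / (2 * real M + 1))" and ?q = "sqrt (1 / (2 * real M + 1))"
  have sq: "?p * ?p = 2 * real M / (2 * real M + 1)" "?q * ?q = 1 / (2 * real M + 1)"
    by simp_all
  have i: "ket_phi M $ 0 = complex_of_real ?p" "ket_phi M $ 1 = complex_of_real ?q"
    "dim_vec (ket_phi M) = 2"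
    by (simp_all add: ket_phi_def ket_def)
  have s: "(\<Sum>i<2. f i) = f 0 + f 1" "(\<Sum>i\<in>{0..<2}. f i) = f 0 + f 1" for f :: "nat \<Rightarrow> complex"
    by (simp_all add: numeral_2_eq_2)
  have p: "(ket_proj c *\<^sub>v ket_phi M) $ i = (if i = c then ket_phi M $ c else 0)" if "i < 2" "c < 2" for c i
  proof -
    have "i = 0 \<or> i = 1" "c = 0 \<or> c = 1" using that by auto
    then show ?thesis by (auto simp: ket_proj_def scalar_prod_def i(3) s ket_def)
  qed
  have b: "braket (ket_phi M) (ket_proj 0 *\<^sub>v ket_phi M) = complex_of_real (?p * ?p)"
    "braket (ket_phi M) (ket_proj 1 *\<^sub>v ket_phi M) = complex_of_real (?q * ?q)"
    "braket (ket_phi M) (ket_phi M) = complex_of_real (?p * ?p + ?q * ?q)"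
    \<comment> \<open>The removed simplification rules would rewrite the squares of the amplitudes
      and the index 1, which must keep the form in which \<open>sq\<close> and \<open>i\<close>
      speak of them.\<close>
    unfolding braket_sum i(3) s by (simp_all add: p i del: real_sqrt_mult_self One_nat_def)
  show "braket (ket_phi M) (ket_proj 0 *\<^sub>v ket_phi M) = complex_of_real (2 * real M / (2 * real M + 1))"
    "braket (ket_phi M) (ket_proj 1 *\<^sub>v ket_phi M) = complex_of_real (1 / (2 * real M + 1))"
    unfolding b sq by simp_all
  have "?p * ?p + ?q * ?q = (2 * real M + 1) / (2 * real M + 1)"
    unfolding sq by (simp only: add_divide_distrib)
  then show "braket (ket_phi M) (ket_phi M) = 1" unfolding b by simp
qed

lemma braket_ctrl_U_prod:
  assumes b: "\<And>k i. k \<in> {1..n} \<Longrightarrow> i \<in> {1..N} \<Longrightarrow> b k i \<in> {0, 1, 2, 3}"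
    and ks: "distinct ks" "set ks \<subseteq> {1..n}"
    and u: "u \<in> carrier_vec (2 ^ N)" and v: "v \<in> carrier_vec (2 ^ N)"
    and ws: "length ws = n" "set ws \<subseteq> carrier_vec 2" "\<And>k. k \<in> set ks \<Longrightarrow> ws ! (k - 1) = ket_phi M"
  shows "braket (kron_vecs (u # replicate n (ket_phi M)))
      (mat_prod (2 ^ N * 2 ^ n) (map (ctrl_U N n h b) ks) *\<^sub>v kron_vecs (v # ws)) =
    braket u (mat_prod (2 ^ N) (map (\<lambda>k. complex_of_real (sgn (h k)) \<cdot>\<^sub>m pauli_string N (b k)
      + complex_of_real (2 * real M) \<cdot>\<^sub>m 1\<^sub>m (2 ^ N)) ks) *\<^sub>v v)
    / complex_of_real ((2 * real M + 1) ^ length ks) * prod_list (map (braket (ket_phi M)) ws)"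
  using ks v ws
proof (induction ks arbitrary: v ws rule: rev_induct)
  case Nil
  have "kron_vecs (v # ws) \<in> carrier_vec (2 ^ N * 2 ^ n)"
    using Nil.prems by (intro kron_vecs_carrier)
  moreover have "braket (kron_vecs (u # replicate n (ket_phi M))) (kron_vecs (v # ws)) =
      prod_list (map2 braket (u # replicate n (ket_phi M)) (v # ws))"
    using Nil.prems u ket_phi_carrier[of M]
    by (intro braket_kron_vecs) (auto simp: list_all2_conv_all_nth nth_Cons split: nat.split dest: nth_mem)
  moreover have "map2 braket (replicate n (ket_phi M)) ws = map (braket (ket_phi M)) ws"
    using Nil.prems(4) by (intro nth_equalityI) auto
  ultimately show ?case using Nil.prems by (simp del: kron_vecs_simps)
next
  case (snoc k ks)
  let ?Q = "complex_of_real (sgn (h k)) \<cdot>\<^sub>m pauli_string N (b k)"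
  let ?S = "\<lambda>k. complex_of_real (sgn (h k)) \<cdot>\<^sub>m pauli_string N (b k)
      + complex_of_real (2 * real M) \<cdot>\<^sub>m 1\<^sub>m (2 ^ N)"
  let ?G = "mat_prod (2 ^ N) (map ?S ks)"
  let ?D = "2 ^ N * 2 ^ n :: nat"
  let ?U = "mat_prod ?D (map (ctrl_U N n h b) ks)"
  let ?w = "kron_vecs (u # replicate n (ket_phi M))"
  let ?ws = "\<lambda>c. ws[k - 1 := ket_proj c *\<^sub>v ket_phi M]"
  let ?E = "prod_list (map (braket (ket_phi M)) ws)"
  let ?m = "complex_of_real (2 * real M + 1)"
  note v = \<open>v \<in> carrier_vec (2 ^ N)\<close>
  have k: "k \<in> {1..n}" "k \<notin> set ks" "distinct ks" "set ks \<subseteq> {1..n}" using snoc.prems by auto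
  have wsk: "ws ! (k - 1) = ket_phi M" using snoc.prems by simp
  have P: "pauli_string N (b j) \<in> carrier_mat (2 ^ N) (2 ^ N)" if "j \<in> {1..n}" for j
    using b[OF that] by (rule pauli_string_carrier)
  have Q: "?Q \<in> carrier_mat (2 ^ N) (2 ^ N)" using P[OF k(1)] by simp
  have I: "1\<^sub>m (2 ^ N) \<in> carrier_mat (2 ^ N) (2 ^ N)" by simp
  have S: "?S j \<in> carrier_mat (2 ^ N) (2 ^ N)" if "j \<in> {1..n}" for j using P[OF that] by simp
  have SS: "set (map ?S ks) \<subseteq> carrier_mat (2 ^ N) (2 ^ N)"
    unfolding set_map using S k(4) by (intro image_subsetI) blast
  then have G: "?G \<in> carrier_mat (2 ^ N) (2 ^ N)" by (intro mat_prod_carrier) blast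
  have Uj: "ctrl_U N n h b j \<in> carrier_mat ?D ?D" if "j \<in> {1..n}" for j
    using b[OF that] by (rule ctrl_U_carrier)
  have UU: "set (map (ctrl_U N n h b) ks) \<subseteq> carrier_mat ?D ?D"
    unfolding set_map using Uj k(4) by (intro image_subsetI) blast
  then have U: "?U \<in> carrier_mat ?D ?D" by (intro mat_prod_carrier) blast
  have wsc: "length (?ws c) = n" "set (?ws c) \<subseteq> carrier_vec 2" for c
  proof -
    have "ket_proj c *\<^sub>v ket_phi M \<in> carrier_vec 2" by (intro carrier_vecI) (simp add: ket_proj_def)
    then show "length (?ws c) = n" "set (?ws c) \<subseteq> carrier_vec 2"
      using snoc.prems(4,5) by (auto dest: set_update_subset_insert[THEN subsetD])
  qed
  have wsj: "?ws c ! (j - 1) = ket_phi M" if "j \<in> set ks" for j c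
  proof -
    \<comment> \<open>Register B_j sits at list position j - 1. Truncated subtraction is injective
      only on positive numbers, so the lower bounds matter.\<close>
    have "j \<noteq> k" "j \<ge> 1" "k \<ge> 1" using that k by auto
    then have "j - 1 \<noteq> k - 1" by linarith
    then show ?thesis using snoc.prems that by simp
  qed
  have Qv: "?Q *\<^sub>v v \<in> carrier_vec (2 ^ N)" using Q v by simp
  have x: "kron_vecs (x # ?ws c) \<in> carrier_vec ?D" if "x \<in> carrier_vec (2 ^ N)" for x c
    by (rule kron_vecs_carrier[OF that wsc])
  have w: "?w \<in> carrier_vec ?D" using u ket_phi_carrier by (intro kron_vecs_carrier) auto
  have "ctrl_U N n h b k *\<^sub>v kron_vecs (v # ws) =
      on_branch n k 0 (1\<^sub>m (2 ^ N)) *\<^sub>v kron_vecs (v # ws) + on_branch n k 1 ?Q *\<^sub>v kron_vecs (v # ws)"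
    unfolding ctrl_U_def
    by (rule add_mult_distrib_mat_vec[OF on_branch_carrier[OF I] on_branch_carrier[OF Q]
          kron_vecs_carrier[OF snoc.prems(3-5)]])
  also have "\<dots> = kron_vecs (v # ?ws 0) + kron_vecs ((?Q *\<^sub>v v) # ?ws 1)"
    using on_branch_mult_kron_vecs[OF I v snoc.prems(4,5) k(1)]
      on_branch_mult_kron_vecs[OF Q v snoc.prems(4,5) k(1)] v
    by (simp only: wsk one_mult_mat_vec)
  finally have split: "ctrl_U N n h b k *\<^sub>v kron_vecs (v # ws) =
      kron_vecs (v # ?ws 0) + kron_vecs ((?Q *\<^sub>v v) # ?ws 1)" .
  have "mat_prod ?D (map (ctrl_U N n h b) (ks @ [k])) *\<^sub>v kron_vecs (v # ws) =
      (?U * ctrl_U N n h b k) *\<^sub>v kron_vecs (v # ws)"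
    using mat_prod_snoc[OF UU Uj[OF k(1)]] by (simp only: map_append list.map)
  also have "\<dots> = ?U *\<^sub>v kron_vecs (v # ?ws 0) + ?U *\<^sub>v kron_vecs ((?Q *\<^sub>v v) # ?ws 1)"
    unfolding assoc_mult_mat_vec[OF U Uj[OF k(1)] kron_vecs_carrier[OF snoc.prems(3-5)]] split
    by (rule mult_add_distrib_mat_vec[OF U x[OF v] x[OF Qv]])
  finally have sum: "braket ?w (mat_prod ?D (map (ctrl_U N n h b) (ks @ [k])) *\<^sub>v kron_vecs (v # ws)) =
      braket ?w (?U *\<^sub>v kron_vecs (v # ?ws 0)) + braket ?w (?U *\<^sub>v kron_vecs ((?Q *\<^sub>v v) # ?ws 1))"
    using braket_add_right[OF w mult_mat_vec_carrier[OF U x[OF v]] mult_mat_vec_carrier[OF U x[OF Qv]]]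
    by (simp only:)
  \<comment> \<open>Register k held |phi>, with pairing 1, so projecting it inserts exactly the
    weight of branch c.\<close>
  have E: "prod_list (map (braket (ket_phi M)) (?ws c)) = braket (ket_phi M) (ket_proj c *\<^sub>v ket_phi M) * ?E" for c
    using k(1) snoc.prems(4) wsk by (intro prod_list_map_update) (auto simp: braket_ket_phi)
  have IH: "braket ?w (?U *\<^sub>v kron_vecs (x # ?ws c)) =
      braket u (?G *\<^sub>v x) / complex_of_real ((2 * real M + 1) ^ length ks)
      * (braket (ket_phi M) (ket_proj c *\<^sub>v ket_phi M) * ?E)"
    if "x \<in> carrier_vec (2 ^ N)" for x c
    unfolding E[symmetric] by (rule snoc.IH[OF k(3,4) that wsc wsj])
  \<comment> \<open>The idle branch carries weight 2M/(2M+1) on v, the active one 1/(2M+1) on Q v;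
    together they form (Q + 2M) v divided by 2M+1.\<close>
  have scalars: "braket u (?G *\<^sub>v v) / complex_of_real ((2 * real M + 1) ^ length ks)
        * (braket (ket_phi M) (ket_proj 0 *\<^sub>v ket_phi M) * ?E)
      + braket u (?G *\<^sub>v (?Q *\<^sub>v v)) / complex_of_real ((2 * real M + 1) ^ length ks)
        * (braket (ket_phi M) (ket_proj 1 *\<^sub>v ket_phi M) * ?E)
      = (braket u (?G *\<^sub>v (?Q *\<^sub>v v)) + complex_of_real (2 * real M) * braket u (?G *\<^sub>v v))
        / complex_of_real ((2 * real M + 1) ^ length (ks @ [k])) * ?E"
  proof -
    have "x / z * (complex_of_real (2 * real M / (2 * real M + 1)) * ?E)
        + y / z * (complex_of_real (1 / (2 * real M + 1)) * ?E)
        = (y + complex_of_real (2 * real M) * x) / (?m * z) * ?E" for x y z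
      unfolding of_real_divide by (simp add: add_divide_distrib algebra_simps)
    then show ?thesis
      unfolding braket_ket_phi length_append list.size add_Suc_right add_0_right power_Suc of_real_mult .
  qed
  have step: "braket u (?G *\<^sub>v (?Q *\<^sub>v v)) + complex_of_real (2 * real M) * braket u (?G *\<^sub>v v)
      = braket u (mat_prod (2 ^ N) (map ?S (ks @ [k])) *\<^sub>v v)"
  proof -
    have "mat_prod (2 ^ N) (map ?S (ks @ [k])) *\<^sub>v v = (?G * ?S k) *\<^sub>v v"
      using mat_prod_snoc[OF SS S[OF k(1)]] by (simp only: map_append list.map)
    also have "\<dots> = ?G *\<^sub>v (?Q *\<^sub>v v + complex_of_real (2 * real M) \<cdot>\<^sub>v v)"
    proof -
      have "(complex_of_real (2 * real M) \<cdot>\<^sub>m 1\<^sub>m (2 ^ N)) *\<^sub>v v = complex_of_real (2 * real M) \<cdot>\<^sub>v v"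
        using v by (intro eq_vecI) auto
      then have "?S k *\<^sub>v v = ?Q *\<^sub>v v + complex_of_real (2 * real M) \<cdot>\<^sub>v v"
        using add_mult_distrib_mat_vec[OF Q smult_carrier_mat[OF I] v] by simp
      then show ?thesis using assoc_mult_mat_vec[OF G S[OF k(1)] v] by simp
    qed
    also have "\<dots> = ?G *\<^sub>v (?Q *\<^sub>v v) + complex_of_real (2 * real M) \<cdot>\<^sub>v (?G *\<^sub>v v)"
      using mult_add_distrib_mat_vec[OF G Qv smult_carrier_vec[THEN iffD2, OF v]] mult_mat_vec[OF G v] by simp
    finally show ?thesis
      using braket_add_right[OF u mult_mat_vec_carrier[OF G Qv]
          smult_carrier_vec[THEN iffD2, OF mult_mat_vec_carrier[OF G v]]]
        braket_smult_right[OF u mult_mat_vec_carrier[OF G v]] by simp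
  qed
  show ?case unfolding sum IH[OF v] IH[OF Qv] scalars step ..
qed

section \<open>The control qubit C\<close>

lemma ket_plus_carrier: "ket_plus \<in> carrier_vec 2"
  by (auto simp: ket_plus_def ket_def)

lemma braket_ket_plus_ket:
  assumes "c < 2"
  shows "braket ket_plus (ket c) = complex_of_real (1 / sqrt 2)"
proof -
  have s: "(\<Sum>i<2. f i) = f 0 + f 1" for f :: "nat \<Rightarrow> complex"
    by (simp add: numeral_2_eq_2)
  have d: "dim_vec ket_plus = 2" by (simp add: ket_plus_def ket_def)
  have "c = 0 \<or> c = 1" using assms by auto
  then show ?thesis unfolding braket_sum d s by (auto simp: ket_plus_def ket_def)
qed

text \<open>V keeps the basis state of C, so each order of the gates stays in its own branch. Every
  branch receives 1/sqrt 2 from the ket and 1/sqrt 2 from its overlap with the bra, hence the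
  average.\<close>

lemma braket_ctrl_V:
  assumes b: "\<And>k i. k \<in> {1..n} \<Longrightarrow> i \<in> {1..N} \<Longrightarrow> b k i \<in> {0, 1, 2, 3}"
    and w: "w \<in> carrier_vec (2 ^ N * 2 ^ n)"
  shows "braket (kron_vec w ket_plus) (ctrl_V N n h b *\<^sub>v kron_vec w ket_plus) =
    (braket w (mat_prod (2 ^ N * 2 ^ n) (map (ctrl_U N n h b) [1..<Suc n]) *\<^sub>v w)
     + braket w (mat_prod (2 ^ N * 2 ^ n) (map (ctrl_U N n h b) (rev [1..<Suc n])) *\<^sub>v w)) / 2"
proof -
  let ?D = "2 ^ N * 2 ^ n :: nat"
  let ?F = "mat_prod ?D (map (ctrl_U N n h b) [1..<Suc n])"
  let ?B = "mat_prod ?D (map (ctrl_U N n h b) (rev [1..<Suc n]))"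
  let ?s = "complex_of_real (1 / sqrt 2)"
  have U: "ctrl_U N n h b j \<in> carrier_mat ?D ?D" if "j \<in> {1..n}" for j
    using b[OF that] by (rule ctrl_U_carrier)
  have F: "?F \<in> carrier_mat ?D ?D" and B: "?B \<in> carrier_mat ?D ?D"
    using U by (auto intro!: mat_prod_carrier simp: atLeastLessThanSuc_atLeastAtMost simp del: upt_Suc)
  have V: "ctrl_V N n h b \<in> carrier_mat (?D * 2) (?D * 2)"
    using F B unfolding ctrl_V_def by (intro carrier_matI) (simp_all add: ket_proj_def del: upt_Suc)
  have k: "kron_vec x (ket c) \<in> carrier_vec (?D * 2)" if "x \<in> carrier_vec ?D" for x c
    using that by (intro carrier_vecI) (simp add: ket_def)
  have pl: "kron_vec w ket_plus = ?s \<cdot>\<^sub>v (kron_vec w (ket 0) + kron_vec w (ket 1))"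
    unfolding ket_plus_def by (simp add: kron_vec_smult_right kron_vec_add_right ket_def)
  have "ctrl_V N n h b *\<^sub>v kron_vec w ket_plus =
      ?s \<cdot>\<^sub>v (kron_vec (?F *\<^sub>v w) (ket 0) + kron_vec (?B *\<^sub>v w) (ket 1))"
  proof -
    have "ctrl_V N n h b *\<^sub>v kron_vec w (ket 0) = kron_vec (?F *\<^sub>v w) (ket 0)"
      by (rule ctrl_V_ket0[OF _ w]) (rule b)
    moreover have "ctrl_V N n h b *\<^sub>v kron_vec w (ket 1) = kron_vec (?B *\<^sub>v w) (ket 1)"
      by (rule ctrl_V_ket1[OF _ w]) (rule b)
    ultimately show ?thesis
      unfolding pl mult_mat_vec[OF V add_carrier_vec[OF k[OF w] k[OF w]]]
        mult_add_distrib_mat_vec[OF V k[OF w] k[OF w]] by (simp only:)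
  qed
  moreover have Fw: "?F *\<^sub>v w \<in> carrier_vec ?D" "?B *\<^sub>v w \<in> carrier_vec ?D"
    using mult_mat_vec_carrier[OF F w] mult_mat_vec_carrier[OF B w] by simp_all
  moreover have p: "kron_vec w ket_plus \<in> carrier_vec (?D * 2)"
    using w ket_plus_carrier by (intro carrier_vecI) simp
  moreover have "braket (kron_vec w ket_plus) (kron_vec x (ket c)) = ?s * braket w x"
    if "x \<in> carrier_vec ?D" "c < 2" for x c
  proof -
    have "dim_vec w = dim_vec x" "dim_vec ket_plus = dim_vec (ket c)"
      using that w by (simp_all add: ket_plus_def ket_def)
    then show ?thesis using that(2) by (simp add: braket_kron_vec braket_ket_plus_ket)
  qed
  ultimately have "braket (kron_vec w ket_plus) (ctrl_V N n h b *\<^sub>v kron_vec w ket_plus) =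
      ?s * (?s * braket w (?F *\<^sub>v w) + ?s * braket w (?B *\<^sub>v w))"
    using k by (simp add: braket_smult_right[OF p] braket_add_right[OF p] del: upt_Suc)
  also have "\<dots> = (?s * ?s) * (braket w (?F *\<^sub>v w) + braket w (?B *\<^sub>v w))"
    by (simp only: distrib_left mult.assoc)
  also have "?s * ?s = 1 / 2"
    by (simp flip: of_real_mult)
  finally show ?thesis by (simp del: upt_Suc)
qed

text \<open>Since H_k = |h_k| S_k with S_k = Q_k + 2M, both ordered products are the same positive
  scalar m, the absolute value of the product of the h_k, times products of the S_k. Positivity and
  the circuit formula are then statements about the forward product of the S_k and its
  adjoint.\<close>

theorem mainTheorem1:
  fixes N M n :: nat and b :: "nat \<Rightarrow> nat \<Rightarrow> nat" and h :: "nat \<Rightarrow> real"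
  assumes "N \<ge> 1" and "M \<ge> 1" and "n \<le> M"
    and "\<And>k i. k \<in> {1..n} \<Longrightarrow> i \<in> {1..N} \<Longrightarrow> b k i \<in> {0, 1, 2, 3}"
    and "\<And>k. k \<in> {1..n} \<Longrightarrow> h k \<noteq> 0"
  defines "H \<equiv> \<lambda>k. H_term N M (h k) (b k)"
  defines "H_fwd \<equiv> mat_prod (2 ^ N) (map H [1..<Suc n])"
    and "H_bwd \<equiv> mat_prod (2 ^ N) (map H (rev [1..<Suc n]))"
  shows "psd_mat (H_fwd + H_bwd) \<and>
    (\<forall>\<alpha> \<in> carrier_vec (2 ^ N). braket \<alpha> \<alpha> = 1 \<longrightarrow>
       Re (braket \<alpha> (H_bwd *\<^sub>v \<alpha>)) \<ge> 0 \<and>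
       braket (psi_in M n \<alpha>) (ctrl_V N n h b *\<^sub>v psi_in M n \<alpha>) =
         complex_of_real (Re (braket \<alpha> (H_bwd *\<^sub>v \<alpha>)) /
           ((2 * real M + 1) ^ n * \<bar>\<Prod>k = 1..n. h k\<bar>)))"
proof -
  let ?d = "2 ^ N :: nat" and ?ks = "[1..<Suc n]"
  note b = assms(4)
  define Q where "Q k = complex_of_real (sgn (h k)) \<cdot>\<^sub>m pauli_string N (b k)" for k
  define S where "S k = Q k + complex_of_real (2 * real M) \<cdot>\<^sub>m 1\<^sub>m ?d" for k
  define m where "m = \<bar>\<Prod>k = 1..n. h k\<bar>"
  have m: "m > 0" unfolding m_def using assms(5) by simp
  have ks: "set ?ks = {1..n}" "set (rev ?ks) = {1..n}"
    by (simp_all add: atLeastLessThanSuc_atLeastAtMost del: upt_Suc)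
  have P: "pauli_string N (b k) \<in> carrier_mat ?d ?d" if "k \<in> {1..n}" for k
    using b[OF that] by (rule pauli_string_carrier)
  have Q: "Q k \<in> carrier_mat ?d ?d" if "k \<in> {1..n}" for k
    using P[OF that] by (simp add: Q_def)
  have Q_herm: "hermitian_mat (Q k)" "Q k * Q k = 1\<^sub>m ?d" if k: "k \<in> {1..n}" for k
  proof -
    have herm: "hermitian_mat (pauli_string N (b k))"
      and invol: "pauli_string N (b k) * pauli_string N (b k) = 1\<^sub>m ?d"
      using pauli_string_hermitian_involution[of N "b k", OF b[OF k]] by blast+
    show "hermitian_mat (Q k)"
      using herm unfolding hermitian_mat_def Q_def by (simp add: mat_adjoint_smult)
    \<comment> \<open>As \<open>sgn 0 = 0\<close>, this is where h_k being nonzero makes Q_k an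
      involution.\<close>
    have sg: "complex_of_real (sgn (h k)) * complex_of_real (sgn (h k)) = 1"
      using assms(5)[OF k] by (auto simp: sgn_if)
    have "Q k * Q k = (complex_of_real (sgn (h k)) * complex_of_real (sgn (h k)))
        \<cdot>\<^sub>m (pauli_string N (b k) * pauli_string N (b k))"
      unfolding Q_def using P[OF k]
      by (intro eq_matI) (auto simp: algebra_simps)
    then show "Q k * Q k = 1\<^sub>m ?d" unfolding sg invol by (intro eq_matI) auto
  qed
  have S: "S k \<in> carrier_mat ?d ?d" if "k \<in> {1..n}" for k
    using Q[OF that] by (simp add: S_def)
  have S_herm: "hermitian_mat (S k)" if "k \<in> {1..n}" for k
    using Q_herm(1)[OF that] Q[OF that] unfolding hermitian_mat_def S_def
    by (simp add: mat_adjoint_add[of _ ?d ?d] mat_adjoint_smult mat_adjoint_one)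
  have H: "H k = complex_of_real \<bar>h k\<bar> \<cdot>\<^sub>m S k" for k
    by (simp add: H_def H_term_def S_def Q_def)
  let ?F = "mat_prod ?d (map S ?ks)" and ?B = "mat_prod ?d (map S (rev ?ks))"
  have F: "?F \<in> carrier_mat ?d ?d" and B: "?B \<in> carrier_mat ?d ?d"
    using S ks by (auto intro!: mat_prod_carrier simp del: upt_Suc)
  have "prod_list (map (\<lambda>k. complex_of_real \<bar>h k\<bar>) ?ks) = complex_of_real m"
    unfolding m_def abs_prod of_real_prod
    by (subst prod.distinct_set_conv_list[symmetric])
      (simp_all add: atLeastLessThanSuc_atLeastAtMost del: upt_Suc)
  moreover from this have "prod_list (map (\<lambda>k. complex_of_real \<bar>h k\<bar>) (rev ?ks)) = complex_of_real m"
    by (simp only: rev_map[symmetric] prod_list.rev)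
  ultimately have fwd: "H_fwd = complex_of_real m \<cdot>\<^sub>m ?F" and bwd: "H_bwd = complex_of_real m \<cdot>\<^sub>m ?B"
    using S ks mat_prod_smult[of ?ks S ?d "\<lambda>k. complex_of_real \<bar>h k\<bar>"]
      mat_prod_smult[of "rev ?ks" S ?d "\<lambda>k. complex_of_real \<bar>h k\<bar>"]
    unfolding H_fwd_def H_bwd_def H by (simp_all only:)
  have adj: "mat_adjoint ?F = ?B"
    using S S_herm ks by (intro mat_adjoint_mat_prod) blast
  have adj': "mat_adjoint ?B = ?F"
    using S S_herm ks mat_adjoint_mat_prod[of "rev ?ks" S ?d] by (simp del: upt_Suc)
  \<comment> \<open>The backward form is the conjugate of the forward one, so both have the same
    real part and a lower bound for one order serves the other.\<close>
  have cnj: "braket v (?B *\<^sub>v v) = cnj (braket v (?F *\<^sub>v v))" if v: "v \<in> carrier_vec ?d" for v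
    using braket_mat_adjoint[OF F v v] braket_cnj[OF mult_mat_vec_carrier[OF B v] v]
    unfolding adj by (metis complex_cnj_cnj)
  have scale: "braket v ((complex_of_real m \<cdot>\<^sub>m X) *\<^sub>v v) = complex_of_real m * braket v (X *\<^sub>v v)"
    if "v \<in> carrier_vec ?d" "X \<in> carrier_mat ?d ?d" for v X
  proof -
    have "(complex_of_real m \<cdot>\<^sub>m X) *\<^sub>v v = complex_of_real m \<cdot>\<^sub>v (X *\<^sub>v v)"
      using that by (intro eq_vecI) auto
    then show ?thesis using braket_smult_right[OF that(1) mult_mat_vec_carrier[OF that(2,1)]] by simp
  qed
  have pos: "0 \<le> Re (braket v (?F *\<^sub>v v))" if v: "v \<in> carrier_vec ?d" for v
  proof -
    have "S = (\<lambda>k. Q k + complex_of_real (2 * real M) \<cdot>\<^sub>m 1\<^sub>m ?d)"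
      by (simp add: S_def fun_eq_iff)
    moreover have "0 \<le> Re (braket v
        (mat_prod ?d (map (\<lambda>k. Q k + complex_of_real (2 * real M) \<cdot>\<^sub>m 1\<^sub>m ?d) ?ks) *\<^sub>v v))"
    proof (rule Re_braket_shifted_prod_nonneg)
      fix k and w :: "complex vec" assume "k \<in> set ?ks" "w \<in> carrier_vec ?d"
      then show "vnorm (Q k *\<^sub>v w) = vnorm w"
        unfolding ks by (intro vnorm_hermitian_involution[OF Q Q_herm])
    qed (use Q ks assms v in \<open>auto simp del: upt_Suc\<close>)
    ultimately show ?thesis by simp
  qed
  have mF: "complex_of_real m \<cdot>\<^sub>m ?F \<in> carrier_mat ?d ?d"
    and mB: "complex_of_real m \<cdot>\<^sub>m ?B \<in> carrier_mat ?d ?d"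
    by (rule smult_carrier_mat[OF F], rule smult_carrier_mat[OF B])
  have "psd_mat (H_fwd + H_bwd)"
    unfolding psd_mat_def
  proof (intro conjI ballI)
    show "hermitian_mat (H_fwd + H_bwd)"
      unfolding hermitian_mat_def
    proof
      show "square_mat (H_fwd + H_bwd)" unfolding fwd bwd using F B by (simp del: upt_Suc)
      have "mat_adjoint (H_fwd + H_bwd) = H_bwd + H_fwd"
        unfolding fwd bwd mat_adjoint_add[OF mF mB] mat_adjoint_smult adj adj' complex_cnj_complex_of_real ..
      also have "\<dots> = H_fwd + H_bwd"
        unfolding fwd bwd by (rule comm_add_mat[OF mB mF])
      finally show "mat_adjoint (H_fwd + H_bwd) = H_fwd + H_bwd" .
    qed
    fix v :: "complex vec" assume "v \<in> carrier_vec (dim_row (H_fwd + H_bwd))"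
    then have v: "v \<in> carrier_vec ?d" using F B by (simp add: fwd bwd del: upt_Suc)
    have "braket v ((H_fwd + H_bwd) *\<^sub>v v) = braket v (H_fwd *\<^sub>v v) + braket v (H_bwd *\<^sub>v v)"
      unfolding fwd bwd add_mult_distrib_mat_vec[OF mF mB v]
      by (rule braket_add_right[OF v mult_mat_vec_carrier[OF mF v] mult_mat_vec_carrier[OF mB v]])
    \<comment> \<open>The two conjugate terms add up to 2m times the real part of the forward
      form.\<close>
    then show "0 \<le> Re (braket v ((H_fwd + H_bwd) *\<^sub>v v))"
      unfolding fwd bwd scale[OF v F] scale[OF v B] cnj[OF v] using pos[OF v] m by simp
  qed
  moreover have "0 \<le> Re (braket \<alpha> (H_bwd *\<^sub>v \<alpha>)) \<and>
      braket (psi_in M n \<alpha>) (ctrl_V N n h b *\<^sub>v psi_in M n \<alpha>) =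
        complex_of_real (Re (braket \<alpha> (H_bwd *\<^sub>v \<alpha>)) / ((2 * real M + 1) ^ n * m))"
    if \<alpha>: "\<alpha> \<in> carrier_vec ?d" for \<alpha>
  proof
    have re: "Re (braket \<alpha> (H_bwd *\<^sub>v \<alpha>)) = m * Re (braket \<alpha> (?F *\<^sub>v \<alpha>))"
      unfolding bwd scale[OF \<alpha> B] cnj[OF \<alpha>] by simp
    then show "0 \<le> Re (braket \<alpha> (H_bwd *\<^sub>v \<alpha>))" using pos[OF \<alpha>] m by simp
    let ?ws = "replicate n (ket_phi M)"
    let ?w = "kron_vecs (\<alpha> # ?ws)"
    have w: "?w \<in> carrier_vec (?d * 2 ^ n)"
      using \<alpha> ket_phi_carrier by (intro kron_vecs_carrier) auto
    have psi: "psi_in M n \<alpha> = kron_vec ?w ket_plus"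
      unfolding psi_in_def using kron_vecs_snoc[of "\<alpha> # ?ws" ket_plus]
      by (simp del: kron_vecs_simps)
    have S_eq: "(\<lambda>k. complex_of_real (sgn (h k)) \<cdot>\<^sub>m pauli_string N (b k)
        + complex_of_real (2 * real M) \<cdot>\<^sub>m 1\<^sub>m ?d) = S"
      by (simp add: S_def Q_def fun_eq_iff)
    \<comment> \<open>Stated for an arbitrary enumeration of the gates so that it covers both
      branches of C. All registers start in |phi>, hence the leftover product of pairings is
      1.\<close>
    have U: "braket ?w (mat_prod (?d * 2 ^ n) (map (ctrl_U N n h b) js) *\<^sub>v ?w) =
        braket \<alpha> (mat_prod ?d (map S js) *\<^sub>v \<alpha>) / complex_of_real ((2 * real M + 1) ^ n)"
      if js: "distinct js" "set js = {1..n}" for js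
    proof -
      have "length js = n" using distinct_card[OF js(1)] js(2) by simp
      moreover have "k - 1 < n" if "k \<in> set js" for k using that js(2) by auto
      moreover have "set ?ws \<subseteq> carrier_vec 2" using ket_phi_carrier by auto
      ultimately show ?thesis
        using braket_ctrl_U_prod[of n N b js \<alpha> \<alpha> ?ws M h, OF b js(1) _ \<alpha> \<alpha>] js(2)
        unfolding S_eq by (simp add: braket_ket_phi del: kron_vecs_simps)
    qed
    have "braket (psi_in M n \<alpha>) (ctrl_V N n h b *\<^sub>v psi_in M n \<alpha>) =
        (braket \<alpha> (?F *\<^sub>v \<alpha>) / complex_of_real ((2 * real M + 1) ^ n)
         + cnj (braket \<alpha> (?F *\<^sub>v \<alpha>)) / complex_of_real ((2 * real M + 1) ^ n)) / 2"
    proof -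
      have "braket (kron_vec ?w ket_plus) (ctrl_V N n h b *\<^sub>v kron_vec ?w ket_plus) =
          (braket ?w (mat_prod (?d * 2 ^ n) (map (ctrl_U N n h b) ?ks) *\<^sub>v ?w)
           + braket ?w (mat_prod (?d * 2 ^ n) (map (ctrl_U N n h b) (rev ?ks)) *\<^sub>v ?w)) / 2"
        by (rule braket_ctrl_V[OF _ w]) (rule b)
      moreover have "distinct ?ks" "distinct (rev ?ks)" by (simp_all del: upt_Suc)
      ultimately show ?thesis
        unfolding psi cnj[OF \<alpha>, symmetric] using U ks by (simp only:)
    qed
    also have "\<dots> = complex_of_real (Re (braket \<alpha> (?F *\<^sub>v \<alpha>)) / (2 * real M + 1) ^ n)"
      unfolding add_divide_distrib[symmetric] complex_add_cnj by simp
    \<comment> \<open>The circuit value involves only the S_k; the factor m gained in passing to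
      \<open>H_bwd\<close> cancels against the m in the denominator.\<close>
    finally show "braket (psi_in M n \<alpha>) (ctrl_V N n h b *\<^sub>v psi_in M n \<alpha>) =
        complex_of_real (Re (braket \<alpha> (H_bwd *\<^sub>v \<alpha>)) / ((2 * real M + 1) ^ n * m))"
      unfolding re using m by simp
  qed
  ultimately show ?thesis unfolding m_def by blast
qed

end
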